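(* Let $\mathcal{M}$ be a closed, connected, orientable, $n$-dimensional smooth manifold, let $h$ be a fixed smooth Riemannian metric on $\mathcal{M}$, and let $\alpha>0$. Let $x:\mathcal{M}\times[0,T)\to\mathbb{R}^{n+1}$ be a time-dependent embedding evolving by mean curvature flow, $$\frac{\partial}{\partial t}x=-(H\nu)\circ x,\qquad x(\cdot,0)=x_0\ \text{on }\mathcal{M},$$ and let $\psi_\alpha:\mathcal{M}\times[0,T)\to\mathcal{M}$ be a family of diffeomorphisms $\psi_\alpha(t)$ solving the harmonic map heat flow $$\frac{\partial}{\partial t}\psi_\alpha=\frac1\alpha\Delta_{g(t),h}\psi_\alpha,\qquad \psi_\alpha(\cdot,0)=\mathrm{id}(\cdot)\ \text{on }\mathcal{M},$$ where $g(t):=x(t)^*\mathfrak{e}$. Then the mean curvature-DeTurck flow $\hat x_\alpha:\mathcal{M}\times[0,T)\to\mathbb{R}^{n+1}$ defined by $\hat x_\alpha(t):=x(t)\circ\psi_\alpha(t)^{-1}$ satisfies $$\big(\alpha\,\mathbb{1}+(1-\alpha)(\nu\circ\hat x_\alpha)\otimes(\nu\circ\hat x_\alpha)\big)\frac{\partial}{\partial t}\hat x_\alpha=\operatorname{tr}_{\hat g_\alpha}(\nabla^h\nabla\hat x_\alpha),\qquad \hat x_\alpha(\cdot,0)=x_0(\cdot)\ \text{on }\mathcal{M},$$ where $\hat g_\alpha(t):=\hat x_\alpha(t)^*\mathfrak{e}$. In local coordinates, with $\hat X_\alpha$ and $X_0$ the local representations of $\hat x_\alpha$ and $x_0$, $$\big(\alpha\,\mathbb{1}+(1-\alpha)(\nu\circ\hat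 X_\alpha)\otimes(\nu\circ\hat X_\alpha)\big)\frac{\partial}{\partial t}\hat X_\alpha=\hat g_\alpha^{ij}\Big(\frac{\partial^2\hat X_\alpha}{\partial\theta^i\partial\theta^j}-\Gamma(h)^k_{ij}\frac{\partial\hat X_\alpha}{\partial\theta^k}\Big),\qquad \hat X_\alpha(\cdot,0)=X_0(\cdot).$$
   Context: Repeated indices are summed. $\mathfrak{e}$ is the Euclidean metric of $\mathbb{R}^{n+1}$; for an embedding $x$ with local representation $X=x\circ\mathcal{C}^{-1}$ in a chart $\mathcal{C}$, the pull-back metric $x^*\mathfrak{e}$ has components $\frac{\partial X}{\partial\theta^i}\cdot\frac{\partial X}{\partial\theta^j}$. For a metric $g$ with components $g_{ij}$, $(g^{ij})$ is the inverse matrix and $\Gamma(g)^k_{ij}=\frac12g^{kl}(\partial_ig_{lj}+\partial_jg_{li}-\partial_lg_{ij})$. All maps are sufficiently regular: $x$ and $\psi_\alpha$ are at least of class $C^2$ in space and $C^1$ in time. $\Gamma(t):=x(\mathcal{M},t)=\hat x_\alpha(\mathcal{M},t)$; $\nu$ is a unit normal field on $\Gamma(t)$, and the mean curvature $H$ (sum of the principal curvatures) is defined by $H\circ X=-g^{ij}\frac{\partial^2X}{\partial\theta^i\partial\theta^j}\cdot(\nu\circ X)$, $g=x^*\mathfrak{e}$; the vector $H\nu$ does not depend on the choice of $\nu$. $\mathbb{1}$ is the identity matrix of $\mathbb{R}^{n+1}$ and $(a\otimes b)c=a\,(b\cdot c)$. Map Laplacian: for metrics $g,h$ on $\mathcal{M}$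 and $\psi:\mathcal{M}\to\mathcal{M}$ with local representation $\Psi=\mathcal{C}_2\circ\psi\circ\mathcal{C}_1^{-1}$, $\Delta_{g,h}\psi$ is the vector field along $\psi$ whose components in the chart $\mathcal{C}_2$ are $$(\Delta_{g,h}\psi)^q=g^{ij}\Big(\frac{\partial^2\Psi^q}{\partial\theta^i\partial\theta^j}-\Gamma(g)^k_{ij}\frac{\partial\Psi^q}{\partial\theta^k}+(\Gamma(h)^q_{mn}\circ\Psi)\frac{\partial\Psi^m}{\partial\theta^i}\frac{\partial\Psi^n}{\partial\theta^j}\Big),$$ with $g$-quantities in the chart $\mathcal{C}_1$ and $h$-quantities in $\mathcal{C}_2$. $\nabla\hat x_\alpha$ is the differential of $\hat x_\alpha$ (componentwise), $\nabla^h$ the Levi-Civita covariant derivative of $h$, so $\nabla^h_i\nabla_j\hat x_\alpha=\frac{\partial^2\hat X_\alpha}{\partial\theta^i\partial\theta^j}-\Gamma(h)^k_{ij}\frac{\partial\hat X_\alpha}{\partial\theta^k}$ in local coordinates, and $\operatorname{tr}_{\hat g_\alpha}$ is the trace with respect to $\hat g_\alpha$. *)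

theory Defs
  imports "HOL-Analysis.Analysis"
begin

section \<open>Partial derivatives and differentiability classes in \<open>\<real>\<^sup>n\<close>\<close>

definition partial_deriv :: "'n \<Rightarrow> (real^'n \<Rightarrow> 'b::real_normed_vector) \<Rightarrow> real^'n::finite \<Rightarrow> 'b" where
  "partial_deriv i F \<theta> = frechet_derivative F (at \<theta>) (axis i 1)"

definition partial_deriv2 ::
  "'n \<Rightarrow> 'n \<Rightarrow> (real^'n \<Rightarrow> 'b::real_normed_vector) \<Rightarrow> real^'n::finite \<Rightarrow> 'b" where
  "partial_deriv2 i j F = partial_deriv i (partial_deriv j F)"

definition jacobian :: "(real^'n::finite \<Rightarrow> real^'k::finite) \<Rightarrow> real^'n \<Rightarrow> real^'n^'k" where
  "jacobian F \<theta> = matrix (frechet_derivative F (at \<theta>))"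

text \<open>Only used for open sets \<open>U\<close>.\<close>

primrec Ck_on :: "nat \<Rightarrow> (real^'n::finite \<Rightarrow> 'b::real_normed_vector) \<Rightarrow> (real^'n) set \<Rightarrow> bool" where
  "Ck_on 0 F U \<longleftrightarrow> continuous_on U F"
| "Ck_on (Suc k) F U \<longleftrightarrow>
     (\<forall>\<theta>\<in>U. F differentiable (at \<theta>)) \<and> (\<forall>i. Ck_on k (partial_deriv i F) U)"

definition smooth_on :: "(real^'n::finite \<Rightarrow> 'b::real_normed_vector) \<Rightarrow> (real^'n) set \<Rightarrow> bool" where
  "smooth_on F U \<longleftrightarrow> (\<forall>k. Ck_on k F U)"

text \<open>
  Class \<open>C\<^sup>2\<close> in space and \<open>C\<^sup>1\<close> in time: the function, its space derivatives up to order two and its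
  time derivative exist and are jointly continuous on \<open>W \<subseteq> [0,T) \<times> \<real>\<^sup>n\<close>.  Time derivatives at \<open>0\<close>
  are one-sided.
\<close>

definition C21_on ::
  "real \<Rightarrow> (real \<times> (real^'n::finite)) set \<Rightarrow> (real \<Rightarrow> real^'n \<Rightarrow> 'b::real_normed_vector) \<Rightarrow> bool" where
  "C21_on T W F \<longleftrightarrow>
     (\<forall>t\<in>{0..<T}. Ck_on 2 (F t) {\<theta>. (t, \<theta>) \<in> W}) \<and>
     (\<forall>(t, \<theta>)\<in>W. (\<lambda>s. F s \<theta>) differentiable (at t within {0..<T})) \<and>
     continuous_on W (\<lambda>(t, \<theta>). F t \<theta>) \<and>
     (\<forall>i. continuous_on W (\<lambda>(t, \<theta>). partial_deriv i (F t) \<theta>)) \<and>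
     (\<forall>i j. continuous_on W (\<lambda>(t, \<theta>). partial_deriv2 i j (F t) \<theta>)) \<and>
     continuous_on W (\<lambda>(t, \<theta>). vector_derivative (\<lambda>s. F s \<theta>) (at t within {0..<T}))"


section \<open>Smooth manifolds\<close>

text \<open>A chart is a domain with a coordinate map; the values of the map off the domain are irrelevant.\<close>

type_synonym ('a, 'n) chart = "'a set \<times> ('a \<Rightarrow> real^'n)"

abbreviation chart_dom :: "('a, 'n::finite) chart \<Rightarrow> 'a set" where
  "chart_dom C \<equiv> fst C"

abbreviation chart_map :: "('a, 'n::finite) chart \<Rightarrow> 'a \<Rightarrow> real^'n" where
  "chart_map C \<equiv> snd C"

definition chart_img :: "('a, 'n::finite) chart \<Rightarrow> (real^'n) set" where
  "chart_img C = chart_map C ` chart_dom C"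

definition chart_inv :: "('a, 'n::finite) chart \<Rightarrow> real^'n \<Rightarrow> 'a" where
  "chart_inv C = inv_into (chart_dom C) (chart_map C)"

definition is_chart :: "'a topology \<Rightarrow> ('a, 'n::finite) chart \<Rightarrow> bool" where
  "is_chart M C \<longleftrightarrow>
     openin M (chart_dom C) \<and> open (chart_img C) \<and>
     homeomorphic_map (subtopology M (chart_dom C)) (top_of_set (chart_img C)) (chart_map C)"

definition transition :: "('a, 'n::finite) chart \<Rightarrow> ('a, 'n) chart \<Rightarrow> real^'n \<Rightarrow> real^'n" where
  "transition C D = chart_map D \<circ> chart_inv C"

definition compatible :: "('a, 'n::finite) chart \<Rightarrow> ('a, 'n) chart \<Rightarrow> bool" where
  "compatible C D \<longleftrightarrow>
     smooth_on (transition C D) (chart_map C ` (chart_dom C \<inter> chart_dom D)) \<and>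
     smooth_on (transition D C) (chart_map D ` (chart_dom C \<inter> chart_dom D))"

text \<open>The smooth structure is a maximal atlas, so that \<open>A\<close> is the set of all admissible charts.\<close>

definition smooth_manifold :: "'a topology \<Rightarrow> ('a, 'n::finite) chart set \<Rightarrow> bool" where
  "smooth_manifold M A \<longleftrightarrow>
     Hausdorff_space M \<and> second_countable M \<and>
     (\<forall>C\<in>A. is_chart M C) \<and> topspace M = (\<Union>C\<in>A. chart_dom C) \<and>
     (\<forall>C\<in>A. \<forall>D\<in>A. compatible C D) \<and>
     (\<forall>C. is_chart M C \<and> (\<forall>D\<in>A. compatible C D) \<longrightarrow> C \<in> A)"

definition orientable :: "'a topology \<Rightarrow> ('a, 'n::finite) chart set \<Rightarrow> bool" where
  "orientable M A \<longleftrightarrow>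
     (\<exists>B\<subseteq>A. topspace M = (\<Union>C\<in>B. chart_dom C) \<and>
        (\<forall>C\<in>B. \<forall>D\<in>B. \<forall>p\<in>chart_dom C \<inter> chart_dom D.
           det (jacobian (transition C D) (chart_map C p)) > 0))"

abbreviation local_rep :: "('a \<Rightarrow> 'b) \<Rightarrow> ('a, 'n::finite) chart \<Rightarrow> real^'n \<Rightarrow> 'b" where
  "local_rep f C \<equiv> f \<circ> chart_inv C"

abbreviation local_rep2 ::
  "('a \<Rightarrow> 'a) \<Rightarrow> ('a, 'n::finite) chart \<Rightarrow> ('a, 'n) chart \<Rightarrow> real^'n \<Rightarrow> real^'n" where
  "local_rep2 \<psi> C\<^sub>1 C\<^sub>2 \<equiv> chart_map C\<^sub>2 \<circ> \<psi> \<circ> chart_inv C\<^sub>1"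

definition Ck_map :: "nat \<Rightarrow> ('a, 'n::finite) chart set \<Rightarrow> ('a \<Rightarrow> 'b::real_normed_vector) \<Rightarrow> bool" where
  "Ck_map k A f \<longleftrightarrow> (\<forall>C\<in>A. Ck_on k (local_rep f C) (chart_img C))"

definition Ck_selfmap ::
  "nat \<Rightarrow> 'a topology \<Rightarrow> ('a, 'n::finite) chart set \<Rightarrow> ('a \<Rightarrow> 'a) \<Rightarrow> bool" where
  "Ck_selfmap k M A \<psi> \<longleftrightarrow>
     continuous_map M M \<psi> \<and>
     (\<forall>C\<^sub>1\<in>A. \<forall>C\<^sub>2\<in>A. Ck_on k (local_rep2 \<psi> C\<^sub>1 C\<^sub>2)
        {\<theta> \<in> chart_img C\<^sub>1. \<psi> (chart_inv C\<^sub>1 \<theta>) \<in> chart_dom C\<^sub>2})"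

definition Ck_diffeomorphism ::
  "nat \<Rightarrow> 'a topology \<Rightarrow> ('a, 'n::finite) chart set \<Rightarrow> ('a \<Rightarrow> 'a) \<Rightarrow> bool" where
  "Ck_diffeomorphism k M A \<psi> \<longleftrightarrow>
     bij_betw \<psi> (topspace M) (topspace M) \<and>
     Ck_selfmap k M A \<psi> \<and> Ck_selfmap k M A (inv_into (topspace M) \<psi>)"

definition C21_map ::
  "real \<Rightarrow> ('a, 'n::finite) chart set \<Rightarrow> (real \<Rightarrow> 'a \<Rightarrow> 'b::real_normed_vector) \<Rightarrow> bool" where
  "C21_map T A f \<longleftrightarrow>
     (\<forall>C\<in>A. C21_on T ({0..<T} \<times> chart_img C) (\<lambda>t. local_rep (f t) C))"

definition C21_selfmap ::
  "real \<Rightarrow> 'a topology \<Rightarrow> ('a, 'n::finite) chart set \<Rightarrow> (real \<Rightarrow> 'a \<Rightarrow> 'a) \<Rightarrow> bool" where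
  "C21_selfmap T M A \<psi> \<longleftrightarrow>
     continuous_map (prod_topology (top_of_set {0..<T}) M) M (\<lambda>(t, p). \<psi> t p) \<and>
     (\<forall>C\<^sub>1\<in>A. \<forall>C\<^sub>2\<in>A. C21_on T
        {(t, \<theta>). t \<in> {0..<T} \<and> \<theta> \<in> chart_img C\<^sub>1 \<and> \<psi> t (chart_inv C\<^sub>1 \<theta>) \<in> chart_dom C\<^sub>2}
        (\<lambda>t. local_rep2 (\<psi> t) C\<^sub>1 C\<^sub>2))"

definition C2_embedding ::
  "'a topology \<Rightarrow> ('a, 'n::finite) chart set \<Rightarrow> ('a \<Rightarrow> real^'m::finite) \<Rightarrow> bool" where
  "C2_embedding M A f \<longleftrightarrow>
     embedding_map M euclidean f \<and> Ck_map 2 A f \<and>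
     (\<forall>C\<in>A. \<forall>\<theta>\<in>chart_img C. inj (frechet_derivative (local_rep f C) (at \<theta>)))"


section \<open>Metrics, Christoffel symbols and Laplacians\<close>

text \<open>
  A metric is given by its component matrices: \<open>g C \<theta>\<close> is \<open>(g\<^sub>i\<^sub>j)\<close> in the chart \<open>C\<close> at the point with
  coordinates \<open>\<theta>\<close>.
\<close>

type_synonym ('a, 'n) metric = "('a, 'n) chart \<Rightarrow> real^'n \<Rightarrow> real^'n^'n"

definition riemannian_metric :: "('a, 'n::finite) chart set \<Rightarrow> ('a, 'n) metric \<Rightarrow> bool" where
  "riemannian_metric A h \<longleftrightarrow>
     (\<forall>C\<in>A. smooth_on (h C) (chart_img C)) \<and>
     (\<forall>C\<in>A. \<forall>\<theta>\<in>chart_img C.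
        transpose (h C \<theta>) = h C \<theta> \<and> (\<forall>v. v \<noteq> 0 \<longrightarrow> v \<bullet> (h C \<theta> *v v) > 0)) \<and>
     (\<forall>C\<in>A. \<forall>D\<in>A. \<forall>p\<in>chart_dom C \<inter> chart_dom D.
        let J = jacobian (transition C D) (chart_map C p)
        in h C (chart_map C p) = transpose J ** h D (chart_map D p) ** J)"

definition pullback_metric :: "('a \<Rightarrow> real^'m::finite) \<Rightarrow> ('a, 'n::finite) metric" where
  "pullback_metric f C \<theta> =
     (\<chi> i j. partial_deriv i (local_rep f C) \<theta> \<bullet> partial_deriv j (local_rep f C) \<theta>)"

text \<open>\<open>christoffel G k i j \<theta>\<close> is \<open>\<Gamma>(G)\<^sup>k\<^sub>i\<^sub>j\<close> at \<open>\<theta>\<close>, for the component matrix field \<open>G\<close> of a metric.\<close>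

definition christoffel :: "(real^'n::finite \<Rightarrow> real^'n^'n) \<Rightarrow> 'n \<Rightarrow> 'n \<Rightarrow> 'n \<Rightarrow> real^'n \<Rightarrow> real" where
  "christoffel G k i j \<theta> =
     (1/2) * (\<Sum>l\<in>UNIV. matrix_inv (G \<theta>) $ k $ l *
       (partial_deriv i (\<lambda>\<eta>. G \<eta> $ l $ j) \<theta> + partial_deriv j (\<lambda>\<eta>. G \<eta> $ l $ i) \<theta>
        - partial_deriv l (\<lambda>\<eta>. G \<eta> $ i $ j) \<theta>))"

text \<open>
  The components in the chart \<open>C\<^sub>2\<close> of \<open>\<Delta>\<^bsub>g,h\<^esub> \<psi>\<close>, computed in the chart \<open>C\<^sub>1\<close> at the point with
  \<open>C\<^sub>1\<close>-coordinates \<open>\<theta>\<close>.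
\<close>

definition map_laplacian ::
  "('a, 'n::finite) metric \<Rightarrow> ('a, 'n) metric \<Rightarrow> ('a \<Rightarrow> 'a) \<Rightarrow>
   ('a, 'n) chart \<Rightarrow> ('a, 'n) chart \<Rightarrow> real^'n \<Rightarrow> real^'n" where
  "map_laplacian g h \<psi> C\<^sub>1 C\<^sub>2 \<theta> =
     (let \<Psi> = local_rep2 \<psi> C\<^sub>1 C\<^sub>2 in
      \<chi> q. \<Sum>i\<in>UNIV. \<Sum>j\<in>UNIV. matrix_inv (g C\<^sub>1 \<theta>) $ i $ j *
        (partial_deriv2 i j \<Psi> \<theta> $ q
         - (\<Sum>k\<in>UNIV. christoffel (g C\<^sub>1) k i j \<theta> * partial_deriv k \<Psi> \<theta> $ q)
         + (\<Sum>m\<in>UNIV. \<Sum>r\<in>UNIV. christoffel (h C\<^sub>2) q m r (\<Psi> \<theta>) *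
              partial_deriv i \<Psi> \<theta> $ m * partial_deriv j \<Psi> \<theta> $ r)))"

definition covariant_hessian ::
  "('a, 'n::finite) metric \<Rightarrow> ('a \<Rightarrow> real^'m::finite) \<Rightarrow> ('a, 'n) chart \<Rightarrow> 'n \<Rightarrow> 'n \<Rightarrow> real^'n \<Rightarrow> real^'m" where
  "covariant_hessian h f C i j \<theta> =
     partial_deriv2 i j (local_rep f C) \<theta>
     - (\<Sum>k\<in>UNIV. christoffel (h C) k i j \<theta> *\<^sub>R partial_deriv k (local_rep f C) \<theta>)"

text \<open>
  \<open>tr\<^sub>g(\<nabla>\<^sup>h\<nabla>f)\<close> at the point \<open>p\<close>: the vector that is given by \<open>g\<^sup>i\<^sup>j \<nabla>\<^sup>h\<^sub>i\<nabla>\<^sub>j f\<close> in every chart around \<open>p\<close>.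
\<close>

definition trace_hessian ::
  "('a, 'n::finite) chart set \<Rightarrow> ('a, 'n) metric \<Rightarrow> ('a, 'n) metric \<Rightarrow> ('a \<Rightarrow> real^'m::finite) \<Rightarrow> 'a \<Rightarrow> real^'m" where
  "trace_hessian A g h f p =
     (THE v. \<forall>C\<in>A. p \<in> chart_dom C \<longrightarrow>
        v = (\<Sum>i\<in>UNIV. \<Sum>j\<in>UNIV. matrix_inv (g C (chart_map C p)) $ i $ j *\<^sub>R
               covariant_hessian h f C i j (chart_map C p)))"


section \<open>Hypersurfaces and flows\<close>

definition unit_normal_field ::
  "'a topology \<Rightarrow> ('a, 'n::finite) chart set \<Rightarrow> ('a \<Rightarrow> real^'m::finite) \<Rightarrow> (real^'m \<Rightarrow> real^'m) \<Rightarrow> bool" where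
  "unit_normal_field M A f \<nu> \<longleftrightarrow>
     continuous_on (f ` topspace M) \<nu> \<and>
     (\<forall>y\<in>f ` topspace M. norm (\<nu> y) = 1) \<and>
     (\<forall>C\<in>A. \<forall>\<theta>\<in>chart_img C. \<forall>i.
        \<nu> (local_rep f C \<theta>) \<bullet> partial_deriv i (local_rep f C) \<theta> = 0)"

text \<open>\<open>H\<close> is the mean curvature, as a function on the hypersurface \<open>f(M)\<close>, with respect to \<open>\<nu>\<close>.\<close>

definition is_mean_curvature ::
  "('a, 'n::finite) chart set \<Rightarrow> ('a \<Rightarrow> real^'m::finite) \<Rightarrow> (real^'m \<Rightarrow> real^'m) \<Rightarrow> (real^'m \<Rightarrow> real) \<Rightarrow> bool" where
  "is_mean_curvature A f \<nu> H \<longleftrightarrow>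
     (\<forall>C\<in>A. \<forall>\<theta>\<in>chart_img C.
        H (local_rep f C \<theta>) =
          - (\<Sum>i\<in>UNIV. \<Sum>j\<in>UNIV. matrix_inv (pullback_metric f C \<theta>) $ i $ j *
               (partial_deriv2 i j (local_rep f C) \<theta> \<bullet> \<nu> (local_rep f C \<theta>))))"

text \<open>
  \<open>\<partial>\<^sub>t\<psi> = (1/\<alpha>) \<Delta>\<^bsub>g(t),h\<^esub> \<psi>\<close> is an equation between vectors along \<open>\<psi>\<close>, i.e. between their components in
  the charts \<open>C\<^sub>2\<close> around \<open>\<psi>(p,t)\<close>.
\<close>

definition harmonic_map_heat_flow ::
  "real \<Rightarrow> 'a topology \<Rightarrow> ('a, 'n::finite) chart set \<Rightarrow> real \<Rightarrow> (real \<Rightarrow> ('a, 'n) metric) \<Rightarrow> ('a, 'n) metric \<Rightarrow>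
   (real \<Rightarrow> 'a \<Rightarrow> 'a) \<Rightarrow> bool" where
  "harmonic_map_heat_flow T M A \<alpha> g h \<psi> \<longleftrightarrow>
     (\<forall>t\<in>{0..<T}. \<forall>C\<^sub>1\<in>A. \<forall>C\<^sub>2\<in>A. \<forall>p\<in>chart_dom C\<^sub>1. \<psi> t p \<in> chart_dom C\<^sub>2 \<longrightarrow>
        ((\<lambda>s. chart_map C\<^sub>2 (\<psi> s p)) has_vector_derivative
           (1/\<alpha>) *\<^sub>R map_laplacian (g t) h (\<psi> t) C\<^sub>1 C\<^sub>2 (chart_map C\<^sub>1 p)) (at t within {0..<T})) \<and>
     (\<forall>p\<in>topspace M. \<psi> 0 p = p)"

definition mean_curvature_flow ::
  "real \<Rightarrow> 'a topology \<Rightarrow> (real \<Rightarrow> 'a \<Rightarrow> real^'m::finite) \<Rightarrow> (real \<Rightarrow> real^'m \<Rightarrow> real^'m) \<Rightarrow>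
   (real \<Rightarrow> real^'m \<Rightarrow> real) \<Rightarrow> ('a \<Rightarrow> real^'m) \<Rightarrow> bool" where
  "mean_curvature_flow T M x \<nu> H x\<^sub>0 \<longleftrightarrow>
     (\<forall>t\<in>{0..<T}. \<forall>p\<in>topspace M.
        ((\<lambda>s. x s p) has_vector_derivative - (H t (x t p) *\<^sub>R \<nu> t (x t p))) (at t within {0..<T})) \<and>
     (\<forall>p\<in>topspace M. x 0 p = x\<^sub>0 p)"

definition deturck_flow ::
  "'a topology \<Rightarrow> (real \<Rightarrow> 'a \<Rightarrow> 'b) \<Rightarrow> (real \<Rightarrow> 'a \<Rightarrow> 'a) \<Rightarrow> real \<Rightarrow> 'a \<Rightarrow> 'b" where
  "deturck_flow M x \<psi> t = x t \<circ> inv_into (topspace M) (\<psi> t)"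

definition tensor :: "real^'m::finite \<Rightarrow> real^'m \<Rightarrow> real^'m^'m" where
  "tensor a b = (\<chi> i j. a $ i * b $ j)"

lemma tensor_apply: "tensor a b *v c = (b \<bullet> c) *\<^sub>R a"
  by (simp add: tensor_def vec_eq_iff matrix_vector_mult_def inner_vec_def
      sum_distrib_left sum_distrib_right ac_simps)

end

theory Submission
  imports Defs
begin

text \<open>
  Fix a time \<open>t\<close> and a point \<open>p = \<psi>\<^sub>t q\<close>, a chart \<open>C\<close> around \<open>p\<close> and a chart \<open>D\<close> around \<open>q\<close>; let \<open>X\<close>, \<open>Y\<close> and \<open>\<Psi>\<close>
  represent \<open>x\<close>, \<open>x \<circ> \<psi>\<^sup>-\<^sup>1\<close> and \<open>\<psi>\<close>, so that \<open>X = Y \<circ> \<Psi>\<close>.  The curve \<open>\<eta>(s) = D(\<psi>\<^sub>s\<^sup>-\<^sup>1 p)\<close> is continuous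
  because \<open>M\<close> is compact, and \<open>\<Psi>\<^sub>s(\<eta>(s)) = C p\<close> then gives \<open>\<eta>' = - (D\<Psi>)\<^sup>-\<^sup>1 \<partial>\<^sub>t\<Psi>\<close>.  Hence the velocity of
  \<open>x \<circ> \<psi>\<^sup>-\<^sup>1\<close> at \<open>p\<close> is \<open>v = - H \<nu> - (1/\<alpha>) DY(L)\<close> with \<open>L = \<Delta>\<^bsub>g,h\<^esub> \<psi>\<close>, and applying
  \<open>\<alpha> + (1 - \<alpha>) \<nu> \<otimes> \<nu>\<close> yields \<open>- H \<nu> - DY(L)\<close>.  On the other hand the Gauss formula says
  \<open>- H \<nu> = g\<^sup>i\<^sup>j (X\<^sub>i\<^sub>j - \<Gamma>(g)\<^sup>k\<^sub>i\<^sub>j X\<^sub>k)\<close>, and the chain rule for \<open>X = Y \<circ> \<Psi>\<close> turns the right-hand side into the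
  trace of \<open>\<nabla>\<^sup>h\<nabla>Y\<close> plus \<open>DY(L)\<close>.  That the trace does not depend on the chart follows from the same
  computation, since the velocity does not.
\<close>

section \<open>Calculus of partial derivatives\<close>

lemma has_derivative_frechet:
  "F differentiable (at \<theta>) \<Longrightarrow> (F has_derivative frechet_derivative F (at \<theta>)) (at \<theta>)"
  by (simp add: frechet_derivative_works)

lemma frechet_derivative_sum_partial:
  fixes F :: "real^'n::finite \<Rightarrow> 'b::real_normed_vector"
  assumes "F differentiable (at \<theta>)"
  shows "frechet_derivative F (at \<theta>) v = (\<Sum>i\<in>UNIV. v $ i *\<^sub>R partial_deriv i F \<theta>)"
proof -
  have lin: "linear (frechet_derivative F (at \<theta>))"
    by (rule linear_frechet_derivative[OF assms])
  have "v = (\<Sum>i\<in>UNIV. v $ i *\<^sub>R axis i 1)"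
    by (simp add: vec_eq_iff axis_def if_distrib[of "\<lambda>u. _ * u"] cong: if_cong)
  then have "frechet_derivative F (at \<theta>) v = frechet_derivative F (at \<theta>) (\<Sum>i\<in>UNIV. v $ i *\<^sub>R axis i 1)"
    by simp
  also have "\<dots> = (\<Sum>i\<in>UNIV. v $ i *\<^sub>R partial_deriv i F \<theta>)"
    by (simp add: linear_sum[OF lin] linear_scale[OF lin] partial_deriv_def)
  finally show ?thesis .
qed

lemma partial_deriv_eqI:
  "(F has_derivative F') (at \<theta>) \<Longrightarrow> partial_deriv i F \<theta> = F' (axis i 1)"
  unfolding partial_deriv_def by (metis frechet_derivative_at)

text \<open>The Frechet derivative is chosen from the linear maps satisfying the derivative
  predicate. Functions that agree near the point satisfy this predicate for the same maps, so the
  choices coincide, even at points where no derivative exists.\<close>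

lemma partial_deriv_cong:
  assumes "open U" "\<theta> \<in> U" "\<And>\<eta>. \<eta> \<in> U \<Longrightarrow> F \<eta> = G \<eta>"
  shows "partial_deriv i F \<theta> = partial_deriv i G \<theta>"
proof -
  have "(F has_derivative D) (at \<theta>) = (G has_derivative D) (at \<theta>)" for D
    using has_derivative_transform_within_open[OF _ assms(1,2), of F D UNIV G]
      has_derivative_transform_within_open[OF _ assms(1,2), of G D UNIV F] assms(3) by auto
  then show ?thesis
    by (simp add: partial_deriv_def frechet_derivative_def)
qed

lemma differentiable_cong_open:
  assumes "open U" "\<theta> \<in> U" "\<And>\<eta>. \<eta> \<in> U \<Longrightarrow> F \<eta> = G \<eta>" "F differentiable (at \<theta>)"
  shows "G differentiable (at \<theta>)"
  using assms unfolding differentiable_def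
  by (meson has_derivative_transform_within_open)

text \<open>Restriction to a coordinate line, in the form in which the one-dimensional mean value
  theorem is applied to second differences below.\<close>

lemma has_vector_derivative_along_axis:
  assumes "F differentiable (at (c + s *\<^sub>R axis i 1))"
  shows "((\<lambda>s. F (c + s *\<^sub>R axis i 1)) has_vector_derivative
           partial_deriv i F (c + s *\<^sub>R axis i 1)) (at s within S)"
proof -
  have lin: "linear (frechet_derivative F (at (c + s *\<^sub>R axis i 1)))"
    by (rule linear_frechet_derivative[OF assms])
  have "((\<lambda>s. c + s *\<^sub>R axis i 1) has_derivative (\<lambda>h. h *\<^sub>R axis i 1)) (at s within S)"
    by (auto intro!: derivative_eq_intros)
  from has_derivative_compose[OF this has_derivative_frechet[OF assms]]
  show ?thesis
    by (simp add: has_vector_derivative_def partial_deriv_def linear_scale[OF lin])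
qed

subsection \<open>Operations on \<open>C\<^sup>k\<close> functions\<close>

lemma Ck_on_cong:
  assumes "open U" "\<And>\<theta>. \<theta> \<in> U \<Longrightarrow> F \<theta> = G \<theta>"
  shows "Ck_on k F U \<longleftrightarrow> Ck_on k G U"
  using assms(2)
proof (induction k arbitrary: F G)
  case 0
  then show ?case by (simp cong: continuous_on_cong)
next
  case (Suc k)
  have "Ck_on k (partial_deriv i F) U \<longleftrightarrow> Ck_on k (partial_deriv i G) U" for i
    by (rule Suc.IH) (rule partial_deriv_cong[OF assms(1)], auto simp: Suc.prems)
  moreover have "F differentiable (at \<theta>) \<longleftrightarrow> G differentiable (at \<theta>)" if "\<theta> \<in> U" for \<theta>
    using differentiable_cong_open[OF assms(1) that] Suc.prems by metis
  ultimately show ?case by simp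
qed

lemma Ck_on_subset: "Ck_on k F U \<Longrightarrow> V \<subseteq> U \<Longrightarrow> Ck_on k F V"
  by (induction k arbitrary: F) (auto intro: continuous_on_subset)

text \<open>Serves to glue regularity: a map into the manifold is expressed near each point in a
  different chart of the target.\<close>

lemma Ck_on_localI:
  assumes "\<And>\<theta>. \<theta> \<in> U \<Longrightarrow> \<exists>V. open V \<and> \<theta> \<in> V \<and> Ck_on k F V"
  shows "Ck_on k F U"
  using assms
proof (induction k arbitrary: F)
  case 0
  show ?case
    unfolding Ck_on.simps
  proof (rule continuous_at_imp_continuous_on, rule ballI)
    fix \<theta> assume "\<theta> \<in> U"
    with 0 obtain V where "open V" "\<theta> \<in> V" "continuous_on V F" by auto
    then show "isCont F \<theta>" by (simp add: continuous_on_eq_continuous_at)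
  qed
next
  case (Suc k)
  have "Ck_on k (partial_deriv i F) U" for i
    using Suc.prems by (intro Suc.IH) (metis Ck_on.simps(2))
  then show ?case using Suc.prems by auto
qed

text \<open>The common induction step of the closure properties: it suffices to exhibit a formula
  \<open>G i\<close> for the partial derivatives that is valid on \<open>U\<close> and of class one
  lower.\<close>

lemma Ck_on_SucI:
  assumes "open U" "\<And>\<theta>. \<theta> \<in> U \<Longrightarrow> F differentiable (at \<theta>)"
    and "\<And>i. Ck_on k (G i) U" "\<And>i \<theta>. \<theta> \<in> U \<Longrightarrow> partial_deriv i F \<theta> = G i \<theta>"
  shows "Ck_on (Suc k) F U"
proof -
  have "Ck_on k (partial_deriv i F) U" for i
    using Ck_on_cong[OF assms(1,4)] assms(3) by simp
  with assms(2) show ?thesis by simp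
qed

lemma Ck_on_SucD: "Ck_on (Suc k) F U \<Longrightarrow> Ck_on k F U"
proof (induction k arbitrary: F)
  case 0
  then have "F differentiable (at \<theta>)" if "\<theta> \<in> U" for \<theta> using that by simp
  then show ?case
    by (auto intro!: continuous_at_imp_continuous_on differentiable_imp_continuous_within)
next
  case (Suc k)
  then show ?case by (metis Ck_on.simps(2))
qed

lemma partial_deriv_const: "partial_deriv i (\<lambda>_. c) = (\<lambda>_. 0)"
  by (simp add: partial_deriv_def fun_eq_iff)

lemma Ck_on_const: "Ck_on k (\<lambda>_. c) U"
  by (induction k arbitrary: c) (auto simp: partial_deriv_const)

lemma partial_deriv_add:
  assumes "F differentiable (at \<theta>)" "G differentiable (at \<theta>)"
  shows "partial_deriv i (\<lambda>\<theta>. F \<theta> + G \<theta>) \<theta> = partial_deriv i F \<theta> + partial_deriv i G \<theta>"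
  using partial_deriv_eqI[OF has_derivative_add[OF assms[THEN has_derivative_frechet]], of i]
  by (simp add: partial_deriv_def)

lemma Ck_on_add:
  assumes "open U"
  shows "Ck_on k F U \<Longrightarrow> Ck_on k G U \<Longrightarrow> Ck_on k (\<lambda>\<theta>. F \<theta> + G \<theta>) U"
proof (induction k arbitrary: F G)
  case 0
  then show ?case by (simp add: continuous_on_add)
next
  case (Suc k)
  show ?case
  proof (rule Ck_on_SucI[OF assms])
    show "Ck_on k (\<lambda>\<theta>. partial_deriv i F \<theta> + partial_deriv i G \<theta>) U" for i
      using Suc by simp
    fix \<theta> assume "\<theta> \<in> U"
    with Suc.prems have d: "F differentiable (at \<theta>)" "G differentiable (at \<theta>)" by auto
    then show "(\<lambda>\<theta>. F \<theta> + G \<theta>) differentiable (at \<theta>)" by (rule differentiable_add)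
    show "partial_deriv i (\<lambda>\<theta>. F \<theta> + G \<theta>) \<theta> = partial_deriv i F \<theta> + partial_deriv i G \<theta>" for i
      by (rule partial_deriv_add[OF d])
  qed
qed

lemma Ck_on_sum:
  assumes "open U"
  shows "(\<And>i. i \<in> I \<Longrightarrow> Ck_on k (F i) U) \<Longrightarrow> Ck_on k (\<lambda>\<theta>. \<Sum>i\<in>I. F i \<theta>) U"
  by (induction I rule: infinite_finite_induct) (auto simp: Ck_on_const intro!: Ck_on_add[OF assms])

lemma partial_deriv_scaleR:
  assumes "a differentiable (at \<theta>)" "F differentiable (at \<theta>)"
  shows "partial_deriv i (\<lambda>\<theta>. a \<theta> *\<^sub>R F \<theta>) \<theta> = a \<theta> *\<^sub>R partial_deriv i F \<theta> + partial_deriv i a \<theta> *\<^sub>R F \<theta>"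
  using partial_deriv_eqI[OF has_derivative_scaleR[OF assms[THEN has_derivative_frechet]], of i]
  by (simp add: partial_deriv_def)

lemma Ck_on_scaleR:
  assumes "open U"
  shows "Ck_on k a U \<Longrightarrow> Ck_on k F U \<Longrightarrow> Ck_on k (\<lambda>\<theta>. a \<theta> *\<^sub>R F \<theta>) U"
proof (induction k arbitrary: a F)
  case 0
  then show ?case by (simp add: continuous_on_scaleR)
next
  case (Suc k)
  show ?case
  proof (rule Ck_on_SucI[OF assms])
    show "Ck_on k (\<lambda>\<theta>. a \<theta> *\<^sub>R partial_deriv i F \<theta> + partial_deriv i a \<theta> *\<^sub>R F \<theta>) U" for i
      using Suc.prems Suc.prems[THEN Ck_on_SucD] by (intro Ck_on_add[OF assms] Suc.IH) auto
    fix \<theta> assume "\<theta> \<in> U"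
    with Suc.prems have d: "a differentiable (at \<theta>)" "F differentiable (at \<theta>)" by auto
    then show "(\<lambda>\<theta>. a \<theta> *\<^sub>R F \<theta>) differentiable (at \<theta>)" by (rule differentiable_scaleR)
    show "partial_deriv i (\<lambda>\<theta>. a \<theta> *\<^sub>R F \<theta>) \<theta> = a \<theta> *\<^sub>R partial_deriv i F \<theta> + partial_deriv i a \<theta> *\<^sub>R F \<theta>" for i
      by (rule partial_deriv_scaleR[OF d])
  qed
qed

lemma differentiable_vec_nth: "F differentiable net \<Longrightarrow> (\<lambda>\<theta>. F \<theta> $ q) differentiable net"
  unfolding differentiable_def
  by (blast intro: bounded_linear.has_derivative[OF bounded_linear_vec_nth])

lemma partial_deriv_nth:
  assumes "F differentiable (at \<theta>)"
  shows "partial_deriv i (\<lambda>\<theta>. F \<theta> $ q) \<theta> = partial_deriv i F \<theta> $ q"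
  using partial_deriv_eqI[OF bounded_linear.has_derivative[OF bounded_linear_vec_nth has_derivative_frechet[OF assms]]]
  by (simp add: partial_deriv_def)

lemma Ck_on_nth:
  assumes "open U"
  shows "Ck_on k F U \<Longrightarrow> Ck_on k (\<lambda>\<theta>. F \<theta> $ q) U"
proof (induction k arbitrary: F)
  case 0
  then show ?case by (simp add: continuous_on_component)
next
  case (Suc k)
  show ?case
  proof (rule Ck_on_SucI[OF assms])
    show "Ck_on k (\<lambda>\<theta>. partial_deriv i F \<theta> $ q) U" for i
      using Suc by simp
  qed (use Suc.prems in \<open>auto intro: differentiable_vec_nth partial_deriv_nth\<close>)
qed

lemma partial_deriv_compose:
  assumes "F differentiable (at (\<Phi> \<theta>))" "\<Phi> differentiable (at \<theta>)"
  shows "partial_deriv i (F \<circ> \<Phi>) \<theta> = (\<Sum>q\<in>UNIV. partial_deriv i \<Phi> \<theta> $ q *\<^sub>R partial_deriv q F (\<Phi> \<theta>))"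
  using partial_deriv_eqI[OF diff_chain_at[OF assms(2,1)[THEN has_derivative_frechet]], of i]
  by (simp only: o_apply frechet_derivative_sum_partial[OF assms(1)] partial_deriv_def[of i \<Phi> \<theta>])

text \<open>Induction with the outer function arbitrary and the inner one fixed: by the chain rule
  the partial derivatives are sums of products of those of \<Phi> with
  \<open>partial_deriv q F\<close> composed with \<Phi>, and the induction hypothesis applies to the
  latter factor.\<close>

lemma Ck_on_compose:
  assumes "open V"
  shows "Ck_on k F U \<Longrightarrow> Ck_on k \<Phi> V \<Longrightarrow> \<Phi> ` V \<subseteq> U \<Longrightarrow> Ck_on k (F \<circ> \<Phi>) V"
proof (induction k arbitrary: F)
  case 0
  then show ?case by (simp add: continuous_on_compose continuous_on_subset del: o_apply)
next
  case (Suc k)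
  have d: "F differentiable (at (\<Phi> \<theta>))" "\<Phi> differentiable (at \<theta>)" if "\<theta> \<in> V" for \<theta>
    using Suc.prems that by auto
  show ?case
  proof (rule Ck_on_SucI[OF assms])
    show "Ck_on k (\<lambda>\<theta>. \<Sum>q\<in>UNIV. partial_deriv i \<Phi> \<theta> $ q *\<^sub>R (partial_deriv q F \<circ> \<Phi>) \<theta>) V" for i
      using Suc.prems Suc.prems(2)[THEN Ck_on_SucD]
      by (intro Ck_on_sum[OF assms] Ck_on_scaleR[OF assms] Ck_on_nth[OF assms] Suc.IH) auto
    show "partial_deriv i (F \<circ> \<Phi>) \<theta> = (\<Sum>q\<in>UNIV. partial_deriv i \<Phi> \<theta> $ q *\<^sub>R (partial_deriv q F \<circ> \<Phi>) \<theta>)"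
      if "\<theta> \<in> V" for i \<theta>
      by (simp only: partial_deriv_compose[OF d[OF that]] o_apply)
    show "(F \<circ> \<Phi>) differentiable (at \<theta>)" if "\<theta> \<in> V" for \<theta>
      by (rule differentiable_chain_at) (rule d[OF that])+
  qed
qed

section \<open>The chain rule for second derivatives\<close>

lemma Ck_on_2_iff:
  "Ck_on 2 F U \<longleftrightarrow> (\<forall>\<theta>\<in>U. F differentiable (at \<theta>)) \<and>
     (\<forall>i. \<forall>\<theta>\<in>U. partial_deriv i F differentiable (at \<theta>)) \<and>
     (\<forall>i j. continuous_on U (partial_deriv2 i j F))"
  by (auto simp: numeral_2_eq_2 partial_deriv2_def)

lemma partial_deriv_sum:
  assumes "\<And>q. q \<in> I \<Longrightarrow> F q differentiable (at \<theta>)"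
  shows "partial_deriv i (\<lambda>\<theta>. \<Sum>q\<in>I. F q \<theta>) \<theta> = (\<Sum>q\<in>I. partial_deriv i (F q) \<theta>)"
  using partial_deriv_eqI[OF has_derivative_sum[of I F _ "at \<theta>", OF has_derivative_frechet[OF assms]], of i]
  by (simp add: partial_deriv_def)

lemma partial_deriv2_compose:
  fixes F :: "real^'k::finite \<Rightarrow> 'b::real_normed_vector" and \<Phi> :: "real^'n::finite \<Rightarrow> real^'k"
  assumes "open V" "Ck_on 2 F U" "Ck_on 2 \<Phi> V" "\<Phi> ` V \<subseteq> U" "\<theta> \<in> V"
  shows "partial_deriv2 i j (F \<circ> \<Phi>) \<theta> =
    (\<Sum>q\<in>UNIV. partial_deriv2 i j \<Phi> \<theta> $ q *\<^sub>R partial_deriv q F (\<Phi> \<theta>)) +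
    (\<Sum>m\<in>UNIV. \<Sum>r\<in>UNIV. (partial_deriv i \<Phi> \<theta> $ m * partial_deriv j \<Phi> \<theta> $ r) *\<^sub>R partial_deriv2 m r F (\<Phi> \<theta>))"
proof -
  have d: "F differentiable (at (\<Phi> \<eta>))" "\<Phi> differentiable (at \<eta>)"
      "partial_deriv q F differentiable (at (\<Phi> \<eta>))" "partial_deriv j \<Phi> differentiable (at \<eta>)" if "\<eta> \<in> V" for \<eta> q j
    using assms that by (auto simp: Ck_on_2_iff)
  have dc: "(partial_deriv q F \<circ> \<Phi>) differentiable (at \<theta>)" for q
    by (intro differentiable_chain_at d assms)
  have dn: "(\<lambda>\<eta>. partial_deriv j \<Phi> \<eta> $ q) differentiable (at \<theta>)" for q
    by (intro differentiable_vec_nth d assms)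
  \<comment> \<open>The first-order chain rule holds on the whole open set \<open>V\<close>, hence
    it can be differentiated once more at \<theta>.\<close>
  have "partial_deriv2 i j (F \<circ> \<Phi>) \<theta> =
      partial_deriv i (\<lambda>\<eta>. \<Sum>q\<in>UNIV. partial_deriv j \<Phi> \<eta> $ q *\<^sub>R (partial_deriv q F \<circ> \<Phi>) \<eta>) \<theta>"
    unfolding partial_deriv2_def
    by (rule partial_deriv_cong[OF assms(1,5)]) (simp add: partial_deriv_compose d)
  also have "\<dots> = (\<Sum>q\<in>UNIV. partial_deriv j \<Phi> \<theta> $ q *\<^sub>R partial_deriv i (partial_deriv q F \<circ> \<Phi>) \<theta> +
      partial_deriv2 i j \<Phi> \<theta> $ q *\<^sub>R partial_deriv q F (\<Phi> \<theta>))"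
    by (subst partial_deriv_sum)
      (simp_all add: partial_deriv_scaleR[OF dn dc] partial_deriv_nth[OF d(4)] differentiable_scaleR[OF dn dc]
        assms partial_deriv2_def del: o_apply, simp)
  also have "\<dots> = (\<Sum>q\<in>UNIV. (\<Sum>m\<in>UNIV. (partial_deriv i \<Phi> \<theta> $ m * partial_deriv j \<Phi> \<theta> $ q) *\<^sub>R partial_deriv2 m q F (\<Phi> \<theta>)) +
      partial_deriv2 i j \<Phi> \<theta> $ q *\<^sub>R partial_deriv q F (\<Phi> \<theta>))"
    by (simp add: partial_deriv_compose[OF d(3,2)] assms partial_deriv2_def scaleR_sum_right mult.commute)
  also have "\<dots> = (\<Sum>q\<in>UNIV. partial_deriv2 i j \<Phi> \<theta> $ q *\<^sub>R partial_deriv q F (\<Phi> \<theta>)) +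
    (\<Sum>m\<in>UNIV. \<Sum>r\<in>UNIV. (partial_deriv i \<Phi> \<theta> $ m * partial_deriv j \<Phi> \<theta> $ r) *\<^sub>R partial_deriv2 m r F (\<Phi> \<theta>))"
    by (subst sum.swap) (simp add: sum.distrib add.commute)
  finally show ?thesis .
qed

subsection \<open>Symmetry of second derivatives\<close>

text \<open>Two applications of the mean value theorem: the first to the difference of
  \<open>f\<close> along two parallel segments in direction \<open>i\<close>, the second to
  \<open>partial_deriv i f\<close> along a segment in direction \<open>j\<close>.\<close>

lemma second_difference_mean_value:
  fixes f :: "real^'n::finite \<Rightarrow> real"
  assumes d: "\<And>\<eta>. \<eta> \<in> ball \<theta> r \<Longrightarrow> f differentiable (at \<eta>)"
      "\<And>\<eta>. \<eta> \<in> ball \<theta> r \<Longrightarrow> partial_deriv i f differentiable (at \<eta>)"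
    and h: "0 < h" "2 * h < r"
  shows "\<exists>\<xi>. dist \<xi> \<theta> \<le> 2 * h \<and>
    f (\<theta> + h *\<^sub>R axis i 1 + h *\<^sub>R axis j 1) - f (\<theta> + h *\<^sub>R axis i 1) - f (\<theta> + h *\<^sub>R axis j 1) + f \<theta>
      = h\<^sup>2 * partial_deriv2 j i f \<xi>"
proof -
  define e :: "'n \<Rightarrow> real^'n" where "e k = axis k 1" for k
  have b: "\<theta> + s *\<^sub>R e i + u *\<^sub>R e j \<in> ball \<theta> r" "dist (\<theta> + s *\<^sub>R e i + u *\<^sub>R e j) \<theta> \<le> 2 * h"
    if "0 \<le> s" "s \<le> h" "0 \<le> u" "u \<le> h" for s u
  proof -
    have "norm (s *\<^sub>R e i + u *\<^sub>R e j) \<le> s + u"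
      using that by (intro order_trans[OF norm_triangle_ineq]) (simp add: e_def)
    then show "dist (\<theta> + s *\<^sub>R e i + u *\<^sub>R e j) \<theta> \<le> 2 * h"
      using that by (simp add: dist_norm algebra_simps)
    then show "\<theta> + s *\<^sub>R e i + u *\<^sub>R e j \<in> ball \<theta> r"
      using h by (simp add: dist_commute)
  qed
  define \<phi> where "\<phi> s = f (\<theta> + h *\<^sub>R e j + s *\<^sub>R e i) - f (\<theta> + s *\<^sub>R e i)" for s
  have "(\<phi> has_derivative (\<lambda>u. u *\<^sub>R (partial_deriv i f (\<theta> + h *\<^sub>R e j + s *\<^sub>R e i) - partial_deriv i f (\<theta> + s *\<^sub>R e i))))
      (at s within {0..h})" if "0 \<le> s" "s \<le> h" for s
  proof -
    have "f differentiable (at (\<theta> + h *\<^sub>R e j + s *\<^sub>R e i))" "f differentiable (at (\<theta> + s *\<^sub>R e i))"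
      using d(1)[OF b(1)[of s h]] d(1)[OF b(1)[of s 0]] that h by (auto simp: algebra_simps)
    from has_vector_derivative_diff[OF this[unfolded e_def, THEN has_vector_derivative_along_axis]]
    show ?thesis by (simp add: has_vector_derivative_def \<phi>_def[abs_def] e_def)
  qed
  from mvt_simple[OF h(1) this]
  obtain s where s: "0 < s" "s < h" and 1: "\<phi> h - \<phi> 0 =
      h * (partial_deriv i f (\<theta> + s *\<^sub>R e i + h *\<^sub>R e j) - partial_deriv i f (\<theta> + s *\<^sub>R e i))"
    by (auto simp: algebra_simps)
  have "((\<lambda>u. partial_deriv i f (\<theta> + s *\<^sub>R e i + u *\<^sub>R e j)) has_derivative
      (\<lambda>w. w *\<^sub>R partial_deriv2 j i f (\<theta> + s *\<^sub>R e i + u *\<^sub>R e j))) (at u within {0..h})"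
    if "0 \<le> u" "u \<le> h" for u
    using has_vector_derivative_along_axis[OF d(2)[OF b(1)[of s u], unfolded e_def]] s that
    by (simp add: has_vector_derivative_def partial_deriv2_def e_def)
  from mvt_simple[OF h(1) this]
  obtain u where u: "0 < u" "u < h" and 2: "partial_deriv i f (\<theta> + s *\<^sub>R e i + h *\<^sub>R e j) - partial_deriv i f (\<theta> + s *\<^sub>R e i)
      = h * partial_deriv2 j i f (\<theta> + s *\<^sub>R e i + u *\<^sub>R e j)"
    by auto
  show ?thesis
    using 1 2 b(2)[of s u] s u
    by (intro exI[of _ "\<theta> + s *\<^sub>R e i + u *\<^sub>R e j"])
      (auto simp: \<phi>_def e_def[symmetric] power2_eq_square algebra_simps)
qed

text \<open>The second difference is symmetric in \<open>i\<close> and \<open>j\<close>, so both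
  mixed derivatives take a common value at points within \<open>2 * h\<close> of \<theta>. By
  continuity these values lie closer to the two limits than half the supposed gap, a
  contradiction.\<close>

lemma partial_deriv2_commute_real:
  fixes f :: "real^'n::finite \<Rightarrow> real"
  assumes "open U" "Ck_on 2 f U" "\<theta> \<in> U"
  shows "partial_deriv2 i j f \<theta> = partial_deriv2 j i f \<theta>"
proof (rule ccontr)
  assume ne: "\<not> ?thesis"
  define \<epsilon> where "\<epsilon> = dist (partial_deriv2 i j f \<theta>) (partial_deriv2 j i f \<theta>) / 2"
  have "\<epsilon> > 0" using ne by (simp add: \<epsilon>_def)
  have "isCont (partial_deriv2 i j f) \<theta>" "isCont (partial_deriv2 j i f) \<theta>"
    using assms by (auto simp: Ck_on_2_iff continuous_on_eq_continuous_at)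
  then obtain d1 d2 where d12: "d1 > 0" "d2 > 0"
      "\<And>\<xi>. dist \<xi> \<theta> < d1 \<Longrightarrow> dist (partial_deriv2 i j f \<xi>) (partial_deriv2 i j f \<theta>) < \<epsilon>"
      "\<And>\<xi>. dist \<xi> \<theta> < d2 \<Longrightarrow> dist (partial_deriv2 j i f \<xi>) (partial_deriv2 j i f \<theta>) < \<epsilon>"
    using \<open>\<epsilon> > 0\<close> unfolding continuous_at_eps_delta by metis
  obtain r where r: "r > 0" "ball \<theta> r \<subseteq> U"
    using assms openE by blast
  \<comment> \<open>The factor 1/3 keeps \<open>2 * h\<close>, the reach of the intermediate points,
    strictly below all three radii.\<close>
  define h where "h = Min {d1, d2, r} / 3"
  have h: "0 < h" "2 * h < r" "2 * h < d1" "2 * h < d2"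
    using d12 r by (auto simp: h_def min_def)
  have d: "f differentiable (at \<eta>)" "partial_deriv k f differentiable (at \<eta>)" if "\<eta> \<in> ball \<theta> r" for \<eta> k
    using assms r that by (auto simp: Ck_on_2_iff)
  define S where "S = f (\<theta> + h *\<^sub>R axis i 1 + h *\<^sub>R axis j 1) - f (\<theta> + h *\<^sub>R axis i 1) - f (\<theta> + h *\<^sub>R axis j 1) + f \<theta>"
  obtain \<xi> where 1: "dist \<xi> \<theta> \<le> 2 * h" "S = h\<^sup>2 * partial_deriv2 j i f \<xi>"
    using second_difference_mean_value[OF d h(1,2), where i = i and j = j] unfolding S_def by auto
  obtain \<xi>' where 2: "dist \<xi>' \<theta> \<le> 2 * h" "f (\<theta> + h *\<^sub>R axis j 1 + h *\<^sub>R axis i 1) - f (\<theta> + h *\<^sub>R axis j 1)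
      - f (\<theta> + h *\<^sub>R axis i 1) + f \<theta> = h\<^sup>2 * partial_deriv2 i j f \<xi>'"
    using second_difference_mean_value[OF d h(1,2), where i = j and j = i] by auto
  have "\<theta> + h *\<^sub>R axis j 1 + h *\<^sub>R axis i 1 = \<theta> + h *\<^sub>R axis i 1 + h *\<^sub>R axis j 1"
    by (simp only: ac_simps)
  with 2 have e: "h\<^sup>2 * partial_deriv2 j i f \<xi> = h\<^sup>2 * partial_deriv2 i j f \<xi>'"
    unfolding 1(2)[symmetric] S_def by simp
  have "dist \<xi>' \<theta> < d1" "dist \<xi> \<theta> < d2" using 1 2 h by auto
  then have "dist (partial_deriv2 i j f \<xi>') (partial_deriv2 i j f \<theta>) < \<epsilon>"
      "dist (partial_deriv2 j i f \<xi>) (partial_deriv2 j i f \<theta>) < \<epsilon>"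
    using d12 by blast+
  moreover have "partial_deriv2 j i f \<xi> = partial_deriv2 i j f \<xi>'"
    using e h by simp
  ultimately show False
    unfolding \<epsilon>_def dist_real_def by (simp add: abs_if split: if_splits)
qed

text \<open>Reduction to components, since the mean value argument is one for real-valued
  functions.\<close>

lemma partial_deriv2_commute:
  fixes F :: "real^'n::finite \<Rightarrow> real^'m::finite"
  assumes "open U" "Ck_on 2 F U" "\<theta> \<in> U"
  shows "partial_deriv2 i j F \<theta> = partial_deriv2 j i F \<theta>"
proof -
  have "partial_deriv2 i j F \<theta> $ q = partial_deriv2 j i F \<theta> $ q" for q
  proof -
    have "partial_deriv2 i j (\<lambda>\<eta>. F \<eta> $ q) \<theta> = partial_deriv2 i j F \<theta> $ q" for i j
    proof -
      have "partial_deriv2 i j (\<lambda>\<eta>. F \<eta> $ q) \<theta> = partial_deriv i (\<lambda>\<eta>. partial_deriv j F \<eta> $ q) \<theta>"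
        unfolding partial_deriv2_def using assms
        by (intro partial_deriv_cong[OF assms(1,3)] partial_deriv_nth) (auto simp: Ck_on_2_iff)
      also have "\<dots> = partial_deriv2 i j F \<theta> $ q"
        unfolding partial_deriv2_def using assms by (intro partial_deriv_nth) (auto simp: Ck_on_2_iff)
      finally show ?thesis .
    qed
    then show ?thesis
      using partial_deriv2_commute_real[OF assms(1) Ck_on_nth[OF assms(1,2)] assms(3), of i j q] by simp
  qed
  then show ?thesis by (simp add: vec_eq_iff)
qed

subsection \<open>Joint differentiability in time and space\<close>

text \<open>Joint differentiability follows from the time derivative at the point itself together
  with a space derivative that exists nearby and is jointly continuous. The time set is taken
  relative to \<open>{0..<T}\<close>, so that the initial time is covered with a one-sided
  derivative.\<close>

lemma C21_on_has_derivative: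
  fixes F :: "real \<Rightarrow> real^'n::finite \<Rightarrow> 'b::real_normed_vector"
  assumes F: "C21_on T W F" and "t \<in> {0..<T}" "0 < d"
    and sub: "({0..<T} \<inter> ball t d) \<times> ball \<theta> d \<subseteq> W"
  shows "((\<lambda>(s, \<eta>). F s \<eta>) has_derivative
      (\<lambda>(s, v). s *\<^sub>R vector_derivative (\<lambda>s. F s \<theta>) (at t within {0..<T}) + frechet_derivative (F t) (at \<theta>) v))
      (at (t, \<theta>) within ({0..<T} \<inter> ball t d) \<times> ball \<theta> d)"
proof -
  define S where "S = {0..<T} \<inter> ball t d"
  define B where "B s \<eta> = Blinfun (frechet_derivative (F s) (at \<eta>))" for s \<eta>
  have tS: "t \<in> S" "S \<subseteq> {0..<T}" using assms by (auto simp: S_def)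
  have tW: "(t, \<theta>) \<in> W" using assms by auto
  have dF: "F s differentiable (at \<eta>)" if "s \<in> S" "\<eta> \<in> ball \<theta> d" for s \<eta>
  proof -
    from that tS sub have "s \<in> {0..<T}" "(s, \<eta>) \<in> W" by (auto simp: S_def)
    then show ?thesis using F by (auto simp: C21_on_def Ck_on_2_iff)
  qed
  have B: "blinfun_apply (B s \<eta>) = frechet_derivative (F s) (at \<eta>)" if "s \<in> S" "\<eta> \<in> ball \<theta> d" for s \<eta>
    unfolding B_def using has_derivative_bounded_linear[OF has_derivative_frechet[OF dF[OF that]]]
    by (rule bounded_linear_Blinfun_apply)
  have "((\<lambda>s. F s \<theta>) has_vector_derivative vector_derivative (\<lambda>s. F s \<theta>) (at t within {0..<T})) (at t within {0..<T})"
    using F tW by (auto simp: C21_on_def vector_derivative_works)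
  then have 1: "((\<lambda>s. F s \<theta>) has_derivative (\<lambda>s. s *\<^sub>R vector_derivative (\<lambda>s. F s \<theta>) (at t within {0..<T}))) (at t within S)"
    unfolding has_vector_derivative_def using tS(2) by (rule has_derivative_subset)
  have 2: "(F s has_derivative blinfun_apply (B s \<eta>)) (at \<eta> within ball \<theta> d)" if "s \<in> S" "\<eta> \<in> ball \<theta> d" for s \<eta>
    unfolding B[OF that] using has_derivative_frechet[OF dF[OF that]] by (rule has_derivative_at_withinI)
  \<comment> \<open>In finite dimensions, continuity of an operator-valued map can be tested on
    basis vectors, where its values are the partial derivatives.\<close>
  have "continuous_on (S \<times> ball \<theta> d) (\<lambda>(s, \<eta>). B s \<eta>)"
  proof (rule continuous_on_blinfun_componentwise)
    fix b :: "real^'n" assume "b \<in> Basis"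
    then obtain k where b: "b = axis k 1" by (auto simp: Basis_vec_def)
    have "continuous_on (S \<times> ball \<theta> d) (\<lambda>(s, \<eta>). partial_deriv k (F s) \<eta>)"
      using F sub by (auto simp: C21_on_def S_def intro: continuous_on_subset)
    then show "continuous_on (S \<times> ball \<theta> d) (\<lambda>z. blinfun_apply (case z of (s, \<eta>) \<Rightarrow> B s \<eta>) b)"
      by (rule continuous_on_eq) (auto simp: B b partial_deriv_def)
  qed
  then have 3: "continuous (at (t, \<theta>) within S \<times> ball \<theta> d) (\<lambda>(s, \<eta>). B s \<eta>)"
    using tS assms(3) by (simp add: continuous_on_eq_continuous_within)
  from has_derivative_partialsI[OF 1 2 3] tS assms(3)
  show ?thesis by (simp add: B S_def[symmetric])
qed

text \<open>Write \<Delta> for the increment of the curve. Since \<open>G\<close> is constant along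
  the curve, applying \<open>D'\<close> to the linearisation leaves an error of at most
  \<open>K * \<epsilon>\<close> times \<open>\<bar>s - t\<bar> + norm \<Delta>\<close>. With
  \<open>K * \<epsilon>\<close> at most 1/2 the unknown \<Delta> is absorbed, so it is bounded by a
  multiple of \<open>\<bar>s - t\<bar>\<close>; inserted back, this makes the error of smaller
  order. Continuity of the curve is what brings the increments into the range where the
  linearisation is valid.\<close>

lemma implicit_curve_derivative:
  fixes G :: "real \<times> 'a::euclidean_space \<Rightarrow> 'b::euclidean_space"
  assumes G: "(G has_derivative (\<lambda>(s, v). s *\<^sub>R a + D v)) (at (t, \<eta> t) within S \<times> Y)"
    and cont: "(\<eta> \<longlongrightarrow> \<eta> t) (at t within S)"
    and Y: "\<And>s. s \<in> S \<Longrightarrow> \<eta> s \<in> Y"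
    and const: "\<And>s. s \<in> S \<Longrightarrow> G (s, \<eta> s) = G (t, \<eta> t)"
    and D': "linear D'" "\<And>v. D' (D v) = v"
  shows "(\<eta> has_vector_derivative - D' a) (at t within S)"
proof -
  have bl: "bounded_linear D'" using D'(1) by (simp add: linear_conv_bounded_linear)
  obtain K where K: "K > 0" "\<And>w. norm (D' w) \<le> norm w * K"
    using bounded_linear.pos_bounded[OF bl] by blast
  have "\<exists>d>0. \<forall>s\<in>S. norm (s - t) < d \<longrightarrow> norm (\<eta> s - \<eta> t - (s - t) *\<^sub>R (- D' a)) \<le> e * norm (s - t)"
    if "e > 0" for e
  proof -
    \<comment> \<open>The constant that the absorption yields:
      \<open>\<bar>s - t\<bar> + norm \<Delta>\<close> turns out to be at most
      \<open>c * \<bar>s - t\<bar>\<close>.\<close>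
    define c where "c = 2 + 2 * norm (D' a)"
    have "c > 0" by (simp add: c_def add_pos_nonneg)
    define \<epsilon> where "\<epsilon> = min (1/2) (e / c) / K"
    have \<epsilon>: "\<epsilon> > 0" "K * \<epsilon> \<le> 1/2" "K * \<epsilon> * c \<le> e"
      using \<open>e > 0\<close> \<open>c > 0\<close> K by (auto simp: \<epsilon>_def min_def field_simps)
    obtain d where d: "d > 0" "\<And>z. z \<in> S \<times> Y \<Longrightarrow> norm (z - (t, \<eta> t)) < d \<Longrightarrow>
        norm (G z - G (t, \<eta> t) - (\<lambda>(s, v). s *\<^sub>R a + D v) (z - (t, \<eta> t))) \<le> \<epsilon> * norm (z - (t, \<eta> t))"
      using G \<epsilon>(1) unfolding has_derivative_within_alt by blast
    obtain d' where d': "d' > 0" "\<And>s. s \<in> S \<Longrightarrow> s \<noteq> t \<Longrightarrow> dist s t < d' \<Longrightarrow> dist (\<eta> s) (\<eta> t) < d / 2"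
      using tendstoD[OF cont, of "d / 2"] d(1) unfolding eventually_at by auto
    show ?thesis
    proof (intro exI[of _ "min d' (d / 2)"] conjI ballI impI)
      show "0 < min d' (d / 2)" using d d' by simp
      fix s assume s: "s \<in> S" "norm (s - t) < min d' (d / 2)"
      define \<Delta> where "\<Delta> = \<eta> s - \<eta> t"
      have "norm \<Delta> < d / 2"
        using s d'(2)[of s] d(1) by (cases "s = t") (auto simp: \<Delta>_def dist_norm)
      moreover have le: "norm ((s, \<eta> s) - (t, \<eta> t)) \<le> \<bar>s - t\<bar> + norm \<Delta>"
        using norm_Pair_le[of "s - t" \<Delta>] by (simp add: \<Delta>_def)
      ultimately have "norm ((s, \<eta> s) - (t, \<eta> t)) < d" using s by auto
      with d(2)[of "(s, \<eta> s)"] s Y const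
      have "norm ((s - t) *\<^sub>R a + D \<Delta>) \<le> \<epsilon> * norm ((s, \<eta> s) - (t, \<eta> t))"
        using norm_minus_cancel[of "(s - t) *\<^sub>R a + D \<Delta>"] by (simp add: \<Delta>_def)
      also have "\<dots> \<le> \<epsilon> * (\<bar>s - t\<bar> + norm \<Delta>)"
        using le \<epsilon>(1) by simp
      finally have "norm (D' ((s - t) *\<^sub>R a + D \<Delta>)) \<le> \<epsilon> * (\<bar>s - t\<bar> + norm \<Delta>) * K"
        using K by (meson order_trans mult_right_mono less_imp_le)
      moreover have "D' ((s - t) *\<^sub>R a + D \<Delta>) = \<Delta> + (s - t) *\<^sub>R D' a"
        by (simp add: linear_add[OF D'(1)] linear_scale[OF D'(1)] D'(2))
      ultimately have r: "norm (\<Delta> + (s - t) *\<^sub>R D' a) \<le> (K * \<epsilon>) * (\<bar>s - t\<bar> + norm \<Delta>)"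
        by (simp add: mult_ac)
      also have "\<dots> \<le> 1/2 * (\<bar>s - t\<bar> + norm \<Delta>)"
        using \<epsilon>(2) by (intro mult_right_mono) auto
      finally have half: "norm (\<Delta> + (s - t) *\<^sub>R D' a) \<le> 1/2 * (\<bar>s - t\<bar> + norm \<Delta>)" .
      have "norm \<Delta> \<le> norm (\<Delta> + (s - t) *\<^sub>R D' a) + \<bar>s - t\<bar> * norm (D' a)"
        using norm_triangle_ineq4[of "\<Delta> + (s - t) *\<^sub>R D' a" "(s - t) *\<^sub>R D' a"] by simp
      with half have "norm \<Delta> \<le> 1/2 * (\<bar>s - t\<bar> + norm \<Delta>) + \<bar>s - t\<bar> * norm (D' a)"
        by linarith
      then have "\<bar>s - t\<bar> + norm \<Delta> \<le> c * \<bar>s - t\<bar>"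
        by (simp add: c_def algebra_simps)
      then have "(K * \<epsilon>) * (\<bar>s - t\<bar> + norm \<Delta>) \<le> (K * \<epsilon>) * (c * \<bar>s - t\<bar>)"
        using K \<epsilon> by (intro mult_left_mono) auto
      also have "\<dots> \<le> e * \<bar>s - t\<bar>"
        using mult_right_mono[OF \<epsilon>(3), of "\<bar>s - t\<bar>"] by (simp add: mult_ac)
      finally show "norm (\<eta> s - \<eta> t - (s - t) *\<^sub>R (- D' a)) \<le> e * norm (s - t)"
        using r by (simp add: \<Delta>_def)
    qed
  qed
  then show ?thesis
    unfolding has_vector_derivative_def has_derivative_within_alt
    by (simp add: bounded_linear_minus bounded_linear_scaleR_left)
qed

section \<open>The first fundamental form\<close>

lemma
  fixes B :: "real^'n::finite^'n"
  assumes "invertible B"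
  shows matrix_mul_matrix_inv: "B ** matrix_inv B = mat 1"
    and matrix_inv_matrix_mul: "matrix_inv B ** B = mat 1"
  using assms someI_ex[of "\<lambda>C. B ** C = mat 1 \<and> C ** B = mat 1"]
  by (auto simp: invertible_def matrix_inv_def)

lemma matrix_inv_unique:
  fixes B C :: "real^'n::finite^'n"
  assumes "C ** B = mat 1"
  shows "matrix_inv B = C"
proof -
  have "invertible B" using assms invertible_left_inverse by blast
  then have "C ** B ** matrix_inv B = C"
    by (simp add: matrix_mul_assoc[symmetric] matrix_mul_matrix_inv)
  with assms show ?thesis by simp
qed

text \<open>For the family of partial derivatives of an immersion these are the components of the
  pull-back metric. Stated for arbitrary families, a change of coordinates becomes matrix
  algebra.\<close>

definition gram_matrix :: "('n \<Rightarrow> 'b::real_inner) \<Rightarrow> real^'n::finite^'n" where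
  "gram_matrix a = (\<chi> i j. a i \<bullet> a j)"

lemma gram_matrix_nth [simp]: "gram_matrix a $ i $ j = a i \<bullet> a j"
  by (simp add: gram_matrix_def)

text \<open>If \<open>v\<close> is in the kernel, the combination \<open>w\<close> of the vectors
  with coefficients \<open>v\<close> is orthogonal to each of them, hence to itself; so
  \<open>w\<close> vanishes, and independence gives \<open>v = 0\<close>.\<close>

lemma invertible_gram_matrix:
  fixes a :: "'n::finite \<Rightarrow> 'b::real_inner"
  assumes "\<And>v. (\<Sum>i\<in>UNIV. v $ i *\<^sub>R a i) = 0 \<Longrightarrow> v = 0"
  shows "invertible (gram_matrix a)"
proof -
  have "v = 0" if "gram_matrix a *v v = 0" for v :: "real^'n"
  proof -
    define w where "w = (\<Sum>i\<in>UNIV. v $ i *\<^sub>R a i)"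
    have "a i \<bullet> w = (gram_matrix a *v v) $ i" for i
      by (simp add: w_def matrix_vector_mult_def inner_sum_right mult.commute)
    then have "a i \<bullet> w = 0" for i using that by simp
    then have "w \<bullet> w = 0"
      by (subst (1) w_def) (simp add: inner_sum_left)
    then show ?thesis using assms by (simp add: w_def)
  qed
  then show ?thesis
    unfolding invertible_left_inverse matrix_left_invertible_ker by blast
qed

text \<open>\<open>J g\<^sup>-\<^sup>1 J\<^sup>T\<close> inverts \<open>G\<close> when \<open>g = J\<^sup>T G J\<close>, here with \<open>J = (b\<^sub>j\<^sup>m)\<close>.\<close>

lemma matrix_inv_gram_matrix_transform:
  fixes a :: "'n::finite \<Rightarrow> 'b::real_inner" and b :: "'n \<Rightarrow> real^'n"
  assumes ind: "\<And>v. (\<Sum>i\<in>UNIV. v $ i *\<^sub>R (\<Sum>m\<in>UNIV. b i $ m *\<^sub>R a m)) = 0 \<Longrightarrow> v = 0"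
  shows "matrix_inv (gram_matrix a) $ m $ r =
    (\<Sum>i\<in>UNIV. \<Sum>j\<in>UNIV. matrix_inv (gram_matrix (\<lambda>i. \<Sum>m\<in>UNIV. b i $ m *\<^sub>R a m)) $ i $ j * (b i $ m * b j $ r))"
proof -
  define J :: "real^'n^'n" where "J = (\<chi> m i. b i $ m)"
  define g where "g = gram_matrix (\<lambda>i. \<Sum>m\<in>UNIV. b i $ m *\<^sub>R a m)"
  \<comment> \<open>A kernel vector of \<open>J\<close> would be a linear relation among the
    transformed vectors, which \<open>ind\<close> excludes.\<close>
  have "invertible J"
    unfolding invertible_left_inverse matrix_left_invertible_ker
  proof (intro allI impI)
    fix v assume "J *v v = 0"
    then have "(\<Sum>i\<in>UNIV. v $ i * b i $ m) = 0" for m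
      by (simp add: J_def matrix_vector_mult_def vec_eq_iff mult.commute)
    then have "(\<Sum>m\<in>UNIV. (\<Sum>i\<in>UNIV. v $ i * b i $ m) *\<^sub>R a m) = 0" by simp
    moreover have "(\<Sum>m\<in>UNIV. (\<Sum>i\<in>UNIV. v $ i * b i $ m) *\<^sub>R a m) = (\<Sum>i\<in>UNIV. v $ i *\<^sub>R (\<Sum>m\<in>UNIV. b i $ m *\<^sub>R a m))"
      by (simp add: scaleR_sum_left scaleR_sum_right, subst sum.swap, simp)
    ultimately show "v = 0" using ind by simp
  qed
  have "g $ i $ j = (transpose J ** gram_matrix a ** J) $ i $ j" for i j
  proof -
    have "g $ i $ j = (\<Sum>r\<in>UNIV. \<Sum>m\<in>UNIV. b i $ m * (a m \<bullet> a r) * b j $ r)"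
      by (simp add: g_def inner_sum_left inner_sum_right sum_distrib_left mult_ac)
    also have "\<dots> = (transpose J ** gram_matrix a ** J) $ i $ j"
      by (simp add: J_def matrix_matrix_mult_def transpose_def sum_distrib_right)
    finally show ?thesis .
  qed
  then have g: "g = transpose J ** gram_matrix a ** J" by (simp add: vec_eq_iff)
  have "invertible g" unfolding g_def using ind by (rule invertible_gram_matrix)
  \<comment> \<open>This is \<open>matrix_inv g ** g = mat 1\<close> multiplied by \<open>J\<close>
    from the left, with the factorisation of \<open>g\<close> inserted; cancelling the last
    \<open>J\<close> shows that the remaining product inverts the Gram matrix.\<close>
  then have "J ** matrix_inv g ** transpose J ** gram_matrix a ** J = J"
    by (metis g matrix_mul_assoc matrix_inv_matrix_mul matrix_mul_rid)
  then have "J ** matrix_inv g ** transpose J ** gram_matrix a = mat 1"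
    by (metis \<open>invertible J\<close> matrix_mul_assoc matrix_mul_matrix_inv matrix_mul_rid)
  then have "matrix_inv (gram_matrix a) = J ** matrix_inv g ** transpose J"
    by (rule matrix_inv_unique)
  then show ?thesis
    by (simp add: g_def[symmetric] J_def matrix_matrix_mult_def transpose_def sum_distrib_left mult_ac)
      (subst sum.swap, simp add: mult.left_commute)
qed

text \<open>The codimension enters only here.\<close>

lemma orthogonal_to_hyperplane_and_normal_eq_0:
  fixes a :: "'n::finite \<Rightarrow> real^'m::finite"
  assumes codim: "CARD('m) = CARD('n) + 1"
    and ind: "\<And>v. (\<Sum>i\<in>UNIV. v $ i *\<^sub>R a i) = 0 \<Longrightarrow> v = 0"
    and "\<nu> \<noteq> 0" "\<And>i. \<nu> \<bullet> a i = 0" "w \<bullet> \<nu> = 0" "\<And>i. w \<bullet> a i = 0"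
  shows "w = 0"
proof (rule ccontr)
  assume "w \<noteq> 0"
  \<comment> \<open>The tangent vectors, the normal and a nonzero \<open>w\<close> would be
    independent, so \<open>f\<close> would embed a space of dimension n+2 into one of dimension
    n+1.\<close>
  define f :: "(real^'n) \<times> real \<times> real \<Rightarrow> real^'m"
    where "f z = (\<Sum>i\<in>UNIV. fst z $ i *\<^sub>R a i) + fst (snd z) *\<^sub>R \<nu> + snd (snd z) *\<^sub>R w" for z
  have f: "linear f"
    by (rule linearI) (simp_all add: f_def scaleR_add_left sum.distrib scaleR_sum_right scaleR_add_right algebra_simps)
  have "z = 0" if z: "f z = 0" for z
  proof -
    have "\<nu> \<bullet> f z = fst (snd z) * (\<nu> \<bullet> \<nu>)" "w \<bullet> f z = snd (snd z) * (w \<bullet> w)"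
      using assms by (simp_all add: f_def inner_add_right inner_sum_right inner_commute[of \<nu> w])
    then have "fst (snd z) = 0" "snd (snd z) = 0"
      using z \<open>\<nu> \<noteq> 0\<close> \<open>w \<noteq> 0\<close> by simp_all
    moreover from this have "fst z = 0"
      using z ind by (simp add: f_def)
    ultimately show ?thesis by (simp add: prod_eq_iff)
  qed
  then have "inj f" using f by (simp add: linear_injective_0)
  then have "DIM((real^'n) \<times> real \<times> real) \<le> DIM(real^'m)"
    using dim_image_eq[OF f, of UNIV] dim_subset_UNIV[of "range f"] by (simp add: dim_UNIV)
  then show False using codim by simp
qed

section \<open>The Gauss formula and the Laplacian of a composition\<close>

lemma linear_independent_partial_derivs:
  fixes X :: "real^'n::finite \<Rightarrow> 'b::real_normed_vector"
  assumes "X differentiable (at \<theta>)" "inj (frechet_derivative X (at \<theta>))"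
    and "(\<Sum>i\<in>UNIV. v $ i *\<^sub>R partial_deriv i X \<theta>) = 0"
  shows "v = 0"
  using assms linear_injective_0[OF linear_frechet_derivative[OF assms(1)]]
  by (simp add: frechet_derivative_sum_partial)

abbreviation first_fundamental_form :: "(real^'n::finite \<Rightarrow> 'b::real_inner) \<Rightarrow> real^'n \<Rightarrow> real^'n^'n" where
  "first_fundamental_form X \<theta> \<equiv> gram_matrix (\<lambda>i. partial_deriv i X \<theta>)"

lemma partial_deriv_first_fundamental_form:
  fixes X :: "real^'n::finite \<Rightarrow> 'b::real_inner"
  assumes "partial_deriv j X differentiable (at \<theta>)" "partial_deriv l X differentiable (at \<theta>)"
  shows "partial_deriv i (\<lambda>\<eta>. first_fundamental_form X \<eta> $ j $ l) \<theta> =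
    partial_deriv2 i j X \<theta> \<bullet> partial_deriv l X \<theta> + partial_deriv j X \<theta> \<bullet> partial_deriv2 i l X \<theta>"
  using partial_deriv_eqI[OF has_derivative_inner[OF assms[THEN has_derivative_frechet]], of i]
  by (simp add: partial_deriv2_def partial_deriv_def[of i "partial_deriv j X"] partial_deriv_def[of i "partial_deriv l X"] add.commute)

text \<open>The difference \<open>w\<close> of the two sides is orthogonal to the normal by
  inspection and to the tangent vectors because the Christoffel term is the tangential part of the
  second derivative; in codimension one this forces \<open>w = 0\<close>.\<close>

lemma gauss_formula:
  fixes X :: "real^'n::finite \<Rightarrow> real^'m::finite"
  assumes codim: "CARD('m) = CARD('n) + 1"
    and X: "open U" "Ck_on 2 X U" "\<theta> \<in> U" "inj (frechet_derivative X (at \<theta>))"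
    and \<nu>: "norm \<nu> = 1" "\<And>i. \<nu> \<bullet> partial_deriv i X \<theta> = 0"
  shows "partial_deriv2 i j X \<theta> - (\<Sum>k\<in>UNIV. christoffel (first_fundamental_form X) k i j \<theta> *\<^sub>R partial_deriv k X \<theta>)
    = (partial_deriv2 i j X \<theta> \<bullet> \<nu>) *\<^sub>R \<nu>"
proof -
  let ?g = "first_fundamental_form X \<theta>"
  have d: "X differentiable (at \<theta>)" "partial_deriv k X differentiable (at \<theta>)" for k
    using X by (auto simp: Ck_on_2_iff)
  note ind = linear_independent_partial_derivs[OF d(1) X(4)]
  have inv: "(\<Sum>k\<in>UNIV. (partial_deriv l X \<theta> \<bullet> partial_deriv k X \<theta>) * matrix_inv ?g $ k $ m) = (if l = m then 1 else 0)" for l m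
    using matrix_mul_matrix_inv[OF invertible_gram_matrix[of "\<lambda>i. partial_deriv i X \<theta>", OF ind]]
    by (simp add: vec_eq_iff matrix_matrix_mult_def mat_def)
  define \<Gamma> where "\<Gamma> m = partial_deriv2 i j X \<theta> \<bullet> partial_deriv m X \<theta>" for m
  have sym: "partial_deriv2 k l X \<theta> = partial_deriv2 l k X \<theta>" for k l
    by (rule partial_deriv2_commute[OF X(1-3)])
  \<comment> \<open>The product rule produces six terms; by symmetry of second derivatives four of
    them cancel in pairs and the other two are equal.\<close>
  have "partial_deriv i (\<lambda>\<eta>. first_fundamental_form X \<eta> $ m $ j) \<theta> + partial_deriv j (\<lambda>\<eta>. first_fundamental_form X \<eta> $ m $ i) \<theta>
      - partial_deriv m (\<lambda>\<eta>. first_fundamental_form X \<eta> $ i $ j) \<theta> = 2 * \<Gamma> m" for m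
    unfolding partial_deriv_first_fundamental_form[OF d(2) d(2)] \<Gamma>_def sym[of m i] sym[of m j] sym[of j i]
    by (simp add: inner_commute)
  then have \<Gamma>: "christoffel (first_fundamental_form X) k i j \<theta> = (\<Sum>m\<in>UNIV. matrix_inv ?g $ k $ m * \<Gamma> m)" for k
    by (simp only: christoffel_def sum_distrib_left) simp
  define w where "w = partial_deriv2 i j X \<theta> - (\<Sum>k\<in>UNIV. christoffel (first_fundamental_form X) k i j \<theta> *\<^sub>R partial_deriv k X \<theta>)
    - (partial_deriv2 i j X \<theta> \<bullet> \<nu>) *\<^sub>R \<nu>"
  have \<nu>': "\<nu> \<bullet> \<nu> = 1" "partial_deriv k X \<theta> \<bullet> \<nu> = 0" "\<nu> \<bullet> partial_deriv k X \<theta> = 0" for k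
    using \<nu> by (simp_all add: norm_eq_1 inner_commute)
  have "w = 0"
  proof (rule orthogonal_to_hyperplane_and_normal_eq_0[OF codim ind])
    show "\<nu> \<noteq> 0" using \<nu> by auto
    show "w \<bullet> \<nu> = 0"
      by (simp add: w_def inner_diff_left inner_sum_left \<nu>')
    fix l
    show "\<nu> \<bullet> partial_deriv l X \<theta> = 0" by (rule \<nu>)
    \<comment> \<open>Taking the inner product with a tangent vector lowers the index: the metric
      meets its inverse and only \<open>\<Gamma> l\<close> survives.\<close>
    have "(\<Sum>k\<in>UNIV. christoffel (first_fundamental_form X) k i j \<theta> *\<^sub>R partial_deriv k X \<theta>) \<bullet> partial_deriv l X \<theta>
      = (\<Sum>k\<in>UNIV. \<Sum>m\<in>UNIV. (partial_deriv l X \<theta> \<bullet> partial_deriv k X \<theta>) * matrix_inv ?g $ k $ m * \<Gamma> m)"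
      by (simp add: \<Gamma> inner_sum_right sum_distrib_right sum_distrib_left inner_commute[of _ "partial_deriv l X \<theta>"] mult_ac)
    also have "\<dots> = (\<Sum>m\<in>UNIV. (if l = m then 1 else 0) * \<Gamma> m)"
      by (subst sum.swap) (simp only: inv sum_distrib_right[symmetric])
    also have "\<dots> = \<Gamma> l" by (simp add: if_distrib[of "\<lambda>u. u * _"] cong: if_cong)
    finally show "w \<bullet> partial_deriv l X \<theta> = 0"
      by (simp add: w_def inner_diff_left \<Gamma>_def \<nu>')
  qed
  then show ?thesis by (simp add: w_def)
qed

text \<open>The identity is algebraic in the coefficients \<Gamma> and \<Gamma>', which may be
  arbitrary: the inverse metric transforms by the Jacobian of \<Psi>, the second-order chain rule
  splits each summand, and the two \<Gamma>' terms on the right cancel. For Christoffel symbols of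
  the two metrics the last sum is the differential of \<open>Y\<close> applied to the map
  Laplacian.\<close>

lemma laplacian_composition:
  fixes Y :: "real^'n::finite \<Rightarrow> 'b::real_inner" and \<Psi> :: "real^'n \<Rightarrow> real^'n"
    and \<Gamma> \<Gamma>' :: "'n \<Rightarrow> 'n \<Rightarrow> 'n \<Rightarrow> real"
  assumes V: "open V" "Ck_on 2 Y U" "Ck_on 2 \<Psi> V" "\<Psi> ` V \<subseteq> U" "\<theta> \<in> V"
    and inj: "inj (frechet_derivative (Y \<circ> \<Psi>) (at \<theta>))"
  defines "g \<equiv> matrix_inv (first_fundamental_form (Y \<circ> \<Psi>) \<theta>)"
  shows "(\<Sum>i\<in>UNIV. \<Sum>j\<in>UNIV. g $ i $ j *\<^sub>R
      (partial_deriv2 i j (Y \<circ> \<Psi>) \<theta> - (\<Sum>k\<in>UNIV. \<Gamma> k i j *\<^sub>R partial_deriv k (Y \<circ> \<Psi>) \<theta>))) =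
    (\<Sum>m\<in>UNIV. \<Sum>r\<in>UNIV. matrix_inv (first_fundamental_form Y (\<Psi> \<theta>)) $ m $ r *\<^sub>R
      (partial_deriv2 m r Y (\<Psi> \<theta>) - (\<Sum>q\<in>UNIV. \<Gamma>' q m r *\<^sub>R partial_deriv q Y (\<Psi> \<theta>)))) +
    (\<Sum>q\<in>UNIV. (\<Sum>i\<in>UNIV. \<Sum>j\<in>UNIV. g $ i $ j * (partial_deriv2 i j \<Psi> \<theta> $ q
       - (\<Sum>k\<in>UNIV. \<Gamma> k i j * partial_deriv k \<Psi> \<theta> $ q)
       + (\<Sum>m\<in>UNIV. \<Sum>r\<in>UNIV. \<Gamma>' q m r * partial_deriv i \<Psi> \<theta> $ m * partial_deriv j \<Psi> \<theta> $ r)))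
      *\<^sub>R partial_deriv q Y (\<Psi> \<theta>))"
    (is "?L = ?A + ?B")
proof -
  define b where "b i = partial_deriv i \<Psi> \<theta>" for i
  define y where "y q = partial_deriv q Y (\<Psi> \<theta>)" for q
  define z where "z m r = partial_deriv2 m r Y (\<Psi> \<theta>)" for m r
  define p where "p i j = partial_deriv2 i j \<Psi> \<theta>" for i j
  have d: "Y differentiable (at (\<Psi> \<theta>))" "\<Psi> differentiable (at \<theta>)"
    using V by (auto simp: Ck_on_2_iff)
  have pd: "partial_deriv i (Y \<circ> \<Psi>) \<theta> = (\<Sum>q\<in>UNIV. b i $ q *\<^sub>R y q)" for i
    by (simp add: partial_deriv_compose[OF d] b_def y_def)
  have G: "matrix_inv (gram_matrix y) $ m $ r = (\<Sum>i\<in>UNIV. \<Sum>j\<in>UNIV. g $ i $ j * (b i $ m * b j $ r))" for m r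
    unfolding g_def pd
    by (rule matrix_inv_gram_matrix_transform)
      (rule linear_independent_partial_derivs[OF differentiable_chain_at[OF d(2,1)] inj], simp add: pd)
  define Q where "Q m r = z m r - (\<Sum>q\<in>UNIV. \<Gamma>' q m r *\<^sub>R y q)" for m r
  have "?A = (\<Sum>m\<in>UNIV. \<Sum>r\<in>UNIV. \<Sum>i\<in>UNIV. \<Sum>j\<in>UNIV. g $ i $ j *\<^sub>R ((b i $ m * b j $ r) *\<^sub>R Q m r))"
    unfolding z_def[symmetric] y_def[symmetric] Q_def[symmetric] by (simp add: G scaleR_sum_left)
  also have "\<dots> = (\<Sum>i\<in>UNIV. \<Sum>j\<in>UNIV. \<Sum>m\<in>UNIV. \<Sum>r\<in>UNIV. g $ i $ j *\<^sub>R ((b i $ m * b j $ r) *\<^sub>R Q m r))"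
  proof -
    have "(\<Sum>m\<in>UNIV. \<Sum>r\<in>UNIV. \<Sum>i\<in>UNIV. \<Sum>j\<in>UNIV. F m r i j) = (\<Sum>i\<in>UNIV. \<Sum>j\<in>UNIV. \<Sum>m\<in>UNIV. \<Sum>r\<in>UNIV. F m r i j)"
      for F :: "'n \<Rightarrow> 'n \<Rightarrow> 'n \<Rightarrow> 'n \<Rightarrow> 'b"
    proof -
      \<comment> \<open>Merging the indices into pairs makes the exchange of the two double sums a
        single swap.\<close>
      have "(\<Sum>m\<in>UNIV. \<Sum>r\<in>UNIV. \<Sum>i\<in>UNIV. \<Sum>j\<in>UNIV. F m r i j) =
          (\<Sum>x\<in>UNIV. \<Sum>y\<in>UNIV. F (fst x) (snd x) (fst y) (snd y))"
        by (simp add: UNIV_Times_UNIV[symmetric] sum.cartesian_product' del: UNIV_Times_UNIV)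
      also have "\<dots> = (\<Sum>y\<in>UNIV. \<Sum>x\<in>UNIV. F (fst x) (snd x) (fst y) (snd y))"
        by (rule sum.swap)
      also have "\<dots> = (\<Sum>i\<in>UNIV. \<Sum>j\<in>UNIV. \<Sum>m\<in>UNIV. \<Sum>r\<in>UNIV. F m r i j)"
        by (simp add: UNIV_Times_UNIV[symmetric] sum.cartesian_product' del: UNIV_Times_UNIV)
      finally show ?thesis .
    qed
    then show ?thesis .
  qed
  finally have A: "?A = (\<Sum>i\<in>UNIV. \<Sum>j\<in>UNIV. g $ i $ j *\<^sub>R (\<Sum>m\<in>UNIV. \<Sum>r\<in>UNIV. (b i $ m * b j $ r) *\<^sub>R Q m r))"
    by (simp only: scaleR_sum_right)
  define c where "c i j q = p i j $ q - (\<Sum>k\<in>UNIV. \<Gamma> k i j * b k $ q)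
       + (\<Sum>m\<in>UNIV. \<Sum>r\<in>UNIV. \<Gamma>' q m r * b i $ m * b j $ r)" for i j q
  have "?B = (\<Sum>q\<in>UNIV. \<Sum>i\<in>UNIV. \<Sum>j\<in>UNIV. g $ i $ j *\<^sub>R c i j q *\<^sub>R y q)"
    by (simp add: c_def p_def b_def y_def scaleR_sum_left)
  also have "\<dots> = (\<Sum>i\<in>UNIV. \<Sum>q\<in>UNIV. \<Sum>j\<in>UNIV. g $ i $ j *\<^sub>R c i j q *\<^sub>R y q)"
    by (rule sum.swap)
  also have "\<dots> = (\<Sum>i\<in>UNIV. \<Sum>j\<in>UNIV. \<Sum>q\<in>UNIV. g $ i $ j *\<^sub>R c i j q *\<^sub>R y q)"
    by (rule sum.cong[OF refl], rule sum.swap)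
  finally have B: "?B = (\<Sum>i\<in>UNIV. \<Sum>j\<in>UNIV. g $ i $ j *\<^sub>R (\<Sum>q\<in>UNIV. c i j q *\<^sub>R y q))"
    by (simp only: scaleR_sum_right)
  have "partial_deriv2 i j (Y \<circ> \<Psi>) \<theta> - (\<Sum>k\<in>UNIV. \<Gamma> k i j *\<^sub>R partial_deriv k (Y \<circ> \<Psi>) \<theta>) =
      (\<Sum>m\<in>UNIV. \<Sum>r\<in>UNIV. (b i $ m * b j $ r) *\<^sub>R Q m r) + (\<Sum>q\<in>UNIV. c i j q *\<^sub>R y q)" for i j
  proof -
    have 1: "(\<Sum>k\<in>UNIV. \<Gamma> k i j *\<^sub>R (\<Sum>q\<in>UNIV. b k $ q *\<^sub>R y q)) = (\<Sum>q\<in>UNIV. (\<Sum>k\<in>UNIV. \<Gamma> k i j * b k $ q) *\<^sub>R y q)"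
      by (simp add: scaleR_sum_left scaleR_sum_right) (rule sum.swap)
    have "(\<Sum>q\<in>UNIV. (\<Sum>m\<in>UNIV. \<Sum>r\<in>UNIV. \<Gamma>' q m r * b i $ m * b j $ r) *\<^sub>R y q)
        = (\<Sum>q\<in>UNIV. \<Sum>m\<in>UNIV. \<Sum>r\<in>UNIV. (b i $ m * b j $ r) *\<^sub>R (\<Gamma>' q m r *\<^sub>R y q))"
      by (simp add: scaleR_sum_left mult_ac)
    also have "\<dots> = (\<Sum>m\<in>UNIV. \<Sum>q\<in>UNIV. \<Sum>r\<in>UNIV. (b i $ m * b j $ r) *\<^sub>R (\<Gamma>' q m r *\<^sub>R y q))"
      by (rule sum.swap)
    also have "\<dots> = (\<Sum>m\<in>UNIV. \<Sum>r\<in>UNIV. \<Sum>q\<in>UNIV. (b i $ m * b j $ r) *\<^sub>R (\<Gamma>' q m r *\<^sub>R y q))"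
      by (rule sum.cong[OF refl], rule sum.swap)
    finally have 2: "(\<Sum>q\<in>UNIV. (\<Sum>m\<in>UNIV. \<Sum>r\<in>UNIV. \<Gamma>' q m r * b i $ m * b j $ r) *\<^sub>R y q)
        = (\<Sum>m\<in>UNIV. \<Sum>r\<in>UNIV. (b i $ m * b j $ r) *\<^sub>R (\<Sum>q\<in>UNIV. \<Gamma>' q m r *\<^sub>R y q))"
      by (simp only: scaleR_sum_right)
    show ?thesis
      by (simp add: partial_deriv2_compose[OF V] pd 1 p_def[symmetric] b_def[symmetric] y_def[symmetric] z_def[symmetric]
          Q_def c_def scaleR_diff_right scaleR_add_left scaleR_diff_left sum.distrib sum_subtractf 2)
  qed
  then show ?thesis
    unfolding A B by (simp only: scaleR_add_right sum.distrib)
qed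

section \<open>Charts and diffeomorphisms\<close>

lemma
  assumes "is_chart M C"
  shows chart_inv_in_dom: "\<theta> \<in> chart_img C \<Longrightarrow> chart_inv C \<theta> \<in> chart_dom C"
    and chart_map_chart_inv: "\<theta> \<in> chart_img C \<Longrightarrow> chart_map C (chart_inv C \<theta>) = \<theta>"
    and chart_inv_chart_map: "p \<in> chart_dom C \<Longrightarrow> chart_inv C (chart_map C p) = p"
    and chart_map_in_img: "p \<in> chart_dom C \<Longrightarrow> chart_map C p \<in> chart_img C"
    and chart_dom_subset: "chart_dom C \<subseteq> topspace M"
proof -
  show sub: "chart_dom C \<subseteq> topspace M"
    using assms openin_subset by (auto simp: is_chart_def)
  have "inj_on (chart_map C) (topspace (subtopology M (chart_dom C)))"
    using assms homeomorphic_imp_injective_map unfolding is_chart_def by blast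
  then have "inj_on (chart_map C) (chart_dom C)"
    using sub by (simp add: Int_absorb1)
  then show "p \<in> chart_dom C \<Longrightarrow> chart_inv C (chart_map C p) = p"
    by (simp add: chart_inv_def)
  show "\<theta> \<in> chart_img C \<Longrightarrow> chart_inv C \<theta> \<in> chart_dom C" "\<theta> \<in> chart_img C \<Longrightarrow> chart_map C (chart_inv C \<theta>) = \<theta>"
    by (simp_all add: chart_inv_def chart_img_def inv_into_into f_inv_into_f)
  show "p \<in> chart_dom C \<Longrightarrow> chart_map C p \<in> chart_img C"
    by (simp add: chart_img_def)
qed

section \<open>Topology of charts, and diffeomorphisms in coordinates\<close>

lemma continuous_map_chart_inv:
  assumes C: "is_chart M C"
  shows "continuous_map (top_of_set (chart_img C)) M (chart_inv C)"
proof -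
  have dom: "topspace (subtopology M (chart_dom C)) = chart_dom C"
    using chart_dom_subset[OF C] by auto
  from C obtain g where g: "homeomorphic_maps (subtopology M (chart_dom C)) (top_of_set (chart_img C)) (chart_map C) g"
    unfolding is_chart_def homeomorphic_map_maps by blast
  then have "continuous_map (top_of_set (chart_img C)) (subtopology M (chart_dom C)) g"
    by (simp add: homeomorphic_maps_def)
  moreover have "g \<theta> = chart_inv C \<theta>" if "\<theta> \<in> chart_img C" for \<theta>
    using g chart_map_chart_inv[OF C that] chart_inv_in_dom[OF C that]
    unfolding homeomorphic_maps_def dom by metis
  ultimately have "continuous_map (top_of_set (chart_img C)) (subtopology M (chart_dom C)) (chart_inv C)"
    by (metis (no_types, lifting) continuous_map_eq topspace_euclidean_subtopology)
  then show ?thesis by (simp add: continuous_map_in_subtopology)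
qed

lemma openin_chart_map_preimage:
  assumes C: "is_chart M C" and "open B"
  shows "openin M {p \<in> chart_dom C. chart_map C p \<in> B}"
proof -
  have "continuous_map (subtopology M (chart_dom C)) euclidean (chart_map C)"
    using C homeomorphic_imp_continuous_map continuous_map_in_subtopology unfolding is_chart_def by blast
  from openin_continuous_map_preimage[OF this, of B] \<open>open B\<close> chart_dom_subset[OF C]
  have "openin (subtopology M (chart_dom C)) {p \<in> chart_dom C. chart_map C p \<in> B}"
    by (simp add: Int_absorb1)
  then show ?thesis
    using C openin_trans_full unfolding is_chart_def by blast
qed

lemma open_chart_inv_preimage:
  assumes C: "is_chart M C" and D: "is_chart M D" and \<phi>: "continuous_map M M \<phi>"
  shows "open {\<theta> \<in> chart_img C. \<phi> (chart_inv C \<theta>) \<in> chart_dom D}"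
proof -
  have "continuous_map (top_of_set (chart_img C)) M (\<phi> \<circ> chart_inv C)"
    using continuous_map_chart_inv[OF C] \<phi> by (rule continuous_map_compose)
  from openin_continuous_map_preimage[OF this, of "chart_dom D"] D
  have "openin (top_of_set (chart_img C)) {\<theta> \<in> chart_img C. \<phi> (chart_inv C \<theta>) \<in> chart_dom D}"
    by (simp add: is_chart_def)
  then show ?thesis
    using C openin_open_eq unfolding is_chart_def by blast
qed

text \<open>This is continuity in time of the preimage of a fixed point. The pairs of a time
  \<open>s\<close> and a preimage of \<open>p\<close> under \<open>\<psi> s\<close> outside
  \<open>N\<close> form a closed set \<open>K\<close>; projecting along the compact \<open>M\<close>
  is a closed map, so the bad times are closed in \<open>S\<close>, and \<open>t\<close> is not
  among them because \<open>\<psi> t\<close> is injective.\<close>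

lemma eventually_inv_into_in_openin:
  assumes "compact_space M" "Hausdorff_space M"
    and \<psi>: "continuous_map (prod_topology (top_of_set S) M) M (\<lambda>(s, p). \<psi> s p)"
    and bij: "\<And>s. s \<in> S \<Longrightarrow> bij_betw (\<psi> s) (topspace M) (topspace M)"
    and "t \<in> S" "p \<in> topspace M" "openin M N" "inv_into (topspace M) (\<psi> t) p \<in> N"
  shows "\<forall>\<^sub>F s in at t within S. inv_into (topspace M) (\<psi> s) p \<in> N"
proof -
  have inv: "\<psi> s (inv_into (topspace M) (\<psi> s) p) = p" "inv_into (topspace M) (\<psi> s) p \<in> topspace M" if "s \<in> S" for s
    using bij_betw_inv_into_right[OF bij[OF that] \<open>p \<in> topspace M\<close>] bij[OF that] \<open>p \<in> topspace M\<close>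
    by (auto simp: bij_betw_def intro: inv_into_into)
  define K where "K = {z \<in> topspace (prod_topology (top_of_set S) M). (\<lambda>(s, p). \<psi> s p) z \<in> {p}} \<inter> S \<times> (topspace M - N)"
  have "closedin (prod_topology (top_of_set S) M) K"
    unfolding K_def
  proof (rule closedin_Int)
    show "closedin (prod_topology (top_of_set S) M) {z \<in> topspace (prod_topology (top_of_set S) M). (\<lambda>(s, p). \<psi> s p) z \<in> {p}}"
      using assms by (intro closedin_continuous_map_preimage[OF \<psi>]) (simp add: closedin_Hausdorff_sing_eq)
    show "closedin (prod_topology (top_of_set S) M) (S \<times> (topspace M - N))"
      using \<open>openin M N\<close> by (simp add: closedin_prod_Times_iff closedin_diff)
  qed
  then have "closedin (top_of_set S) (fst ` K)"
    using Abstract_Topological_Spaces.closed_map_fst[OF \<open>compact_space M\<close>] unfolding closed_map_def by blast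
  then have "openin (top_of_set S) (S - fst ` K)"
    by (simp add: openin_diff)
  then obtain Q where Q: "open Q" "S - fst ` K = S \<inter> Q"
    unfolding openin_open by auto
  have "t \<notin> fst ` K"
  proof
    assume "t \<in> fst ` K"
    then obtain r where "r \<in> topspace M" "\<psi> t r = p" "r \<notin> N" by (auto simp: K_def)
    then show False
      using bij_betw_inv_into_left[OF bij[OF \<open>t \<in> S\<close>], of r] assms by auto
  qed
  then have "t \<in> Q" using Q \<open>t \<in> S\<close> by blast
  moreover have "inv_into (topspace M) (\<psi> s) p \<in> N" if "s \<in> Q" "s \<in> S" for s
  proof (rule ccontr)
    assume "inv_into (topspace M) (\<psi> s) p \<notin> N"
    then have "(s, inv_into (topspace M) (\<psi> s) p) \<in> K"
      using that inv by (simp add: K_def)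
    then have "s \<in> fst ` K" by force
    then show False using that Q by blast
  qed
  ultimately show ?thesis
    unfolding eventually_at_topological using Q(1) by blast
qed

text \<open>\<open>V\<close> and \<open>W\<close> are the coordinate regions where the
  representations of the inverse and of the diffeomorphism make sense; on them these are mutually
  inverse, which lets the later arguments work in open subsets of Euclidean space.\<close>

lemma diffeomorphism_in_charts:
  fixes C D :: "('a, 'n::finite) chart"
  assumes "smooth_manifold M A" "Ck_diffeomorphism k M A \<psi>" "C \<in> A" "D \<in> A"
  defines "\<phi> \<equiv> inv_into (topspace M) \<psi>"
  defines "V \<equiv> {\<theta> \<in> chart_img C. \<phi> (chart_inv C \<theta>) \<in> chart_dom D}"
    and "W \<equiv> {\<eta> \<in> chart_img D. \<psi> (chart_inv D \<eta>) \<in> chart_dom C}"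
  shows "open V" "open W" "Ck_on k (local_rep2 \<phi> C D) V" "Ck_on k (local_rep2 \<psi> D C) W"
    and "\<And>\<theta>. \<theta> \<in> V \<Longrightarrow> local_rep2 \<phi> C D \<theta> \<in> W \<and> local_rep2 \<psi> D C (local_rep2 \<phi> C D \<theta>) = \<theta>"
    and "\<And>\<eta>. \<eta> \<in> W \<Longrightarrow> local_rep2 \<psi> D C \<eta> \<in> V \<and> local_rep2 \<phi> C D (local_rep2 \<psi> D C \<eta>) = \<eta>"
    and "\<And>\<theta>. \<theta> \<in> V \<Longrightarrow> chart_inv D (local_rep2 \<phi> C D \<theta>) = \<phi> (chart_inv C \<theta>)"
    and "\<And>\<eta>. \<eta> \<in> W \<Longrightarrow> chart_inv C (local_rep2 \<psi> D C \<eta>) = \<psi> (chart_inv D \<eta>)"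
proof -
  have C: "is_chart M C" and D: "is_chart M D"
    using assms by (auto simp: smooth_manifold_def)
  note c = chart_inv_in_dom[OF C] chart_map_chart_inv[OF C] chart_inv_chart_map[OF C] chart_map_in_img[OF C] chart_dom_subset[OF C, THEN subsetD]
  note d = chart_inv_in_dom[OF D] chart_map_chart_inv[OF D] chart_inv_chart_map[OF D] chart_map_in_img[OF D] chart_dom_subset[OF D, THEN subsetD]
  have bij: "bij_betw \<psi> (topspace M) (topspace M)" and sm: "Ck_selfmap k M A \<psi>" "Ck_selfmap k M A \<phi>"
    using assms by (auto simp: Ck_diffeomorphism_def)
  have l: "\<phi> (\<psi> p) = p" "\<psi> (\<phi> p) = p" if "p \<in> topspace M" for p
    using bij that by (auto simp: \<phi>_def bij_betw_inv_into_left bij_betw_inv_into_right)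
  show "open V" "open W"
    unfolding V_def W_def using sm C D by (auto intro!: open_chart_inv_preimage simp: Ck_selfmap_def)
  show "Ck_on k (local_rep2 \<phi> C D) V" "Ck_on k (local_rep2 \<psi> D C) W"
    unfolding V_def W_def using sm assms(3,4) by (auto simp: Ck_selfmap_def)
  show "local_rep2 \<phi> C D \<theta> \<in> W \<and> local_rep2 \<psi> D C (local_rep2 \<phi> C D \<theta>) = \<theta>" if "\<theta> \<in> V" for \<theta>
    using that c d l by (simp add: V_def W_def)
  show "local_rep2 \<psi> D C \<eta> \<in> V \<and> local_rep2 \<phi> C D (local_rep2 \<psi> D C \<eta>) = \<eta>" if "\<eta> \<in> W" for \<eta>
    using that c d l by (simp add: V_def W_def)
  show "chart_inv D (local_rep2 \<phi> C D \<theta>) = \<phi> (chart_inv C \<theta>)" if "\<theta> \<in> V" for \<theta>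
    using that c d by (simp add: V_def)
  show "chart_inv C (local_rep2 \<psi> D C \<eta>) = \<psi> (chart_inv D \<eta>)" if "\<eta> \<in> W" for \<eta>
    using that c d by (simp add: W_def)
qed

lemma pullback_metric_eq_first_fundamental_form:
  "pullback_metric f C = first_fundamental_form (local_rep f C)"
  by (rule ext) (simp add: pullback_metric_def gram_matrix_def)

text \<open>The operator acts as the identity on the normal line, since \<alpha> and 1 - \<alpha>
  add up to 1, and as multiplication by \<alpha> on the orthogonal complement, which undoes the
  factor 1/\<alpha>.\<close>

lemma deturck_operator_mult:
  fixes \<nu> w :: "real^'m::finite"
  assumes "norm \<nu> = 1" "\<nu> \<bullet> w = 0" "\<alpha> \<noteq> 0"
  shows "(\<alpha> *\<^sub>R mat 1 + (1 - \<alpha>) *\<^sub>R tensor \<nu> \<nu>) *v (c *\<^sub>R \<nu> - (1/\<alpha>) *\<^sub>R w) = c *\<^sub>R \<nu> - w"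
proof -
  have "\<nu> \<bullet> \<nu> = 1" using assms by (simp add: norm_eq_1)
  with assms show ?thesis
    by (simp add: matrix_vector_mult_add_rdistrib inner_diff_right scaleR_matrix_vector_assoc[symmetric] tensor_apply
        algebra_simps)
qed

section \<open>The DeTurck flow\<close>

text \<open>Two directions of one factorisation: the first gives regularity and the differential of
  the flow map, the second writes \<open>x t\<close> as a composition to which the second-order
  chain rule applies.\<close>

lemma deturck_flow_local_rep:
  assumes "smooth_manifold M A" "Ck_diffeomorphism k M A (\<psi> t)" "C \<in> A" "D \<in> A"
  defines "\<phi> \<equiv> inv_into (topspace M) (\<psi> t)"
  shows "\<theta> \<in> chart_img C \<Longrightarrow> \<phi> (chart_inv C \<theta>) \<in> chart_dom D \<Longrightarrow>
      local_rep (deturck_flow M x \<psi> t) C \<theta> = (local_rep (x t) D \<circ> local_rep2 \<phi> C D) \<theta>"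
    and "\<eta> \<in> chart_img D \<Longrightarrow> \<psi> t (chart_inv D \<eta>) \<in> chart_dom C \<Longrightarrow>
      local_rep (x t) D \<eta> = (local_rep (deturck_flow M x \<psi> t) C \<circ> local_rep2 (\<psi> t) D C) \<eta>"
proof -
  note r = diffeomorphism_in_charts(7,8)[OF assms(1-4), folded \<phi>_def]
  show "\<theta> \<in> chart_img C \<Longrightarrow> \<phi> (chart_inv C \<theta>) \<in> chart_dom D \<Longrightarrow>
      local_rep (deturck_flow M x \<psi> t) C \<theta> = (local_rep (x t) D \<circ> local_rep2 \<phi> C D) \<theta>"
    using r(1)[of \<theta>] by (simp add: deturck_flow_def \<phi>_def)
  assume \<eta>: "\<eta> \<in> chart_img D" "\<psi> t (chart_inv D \<eta>) \<in> chart_dom C"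
  have D: "is_chart M D" and bij: "bij_betw (\<psi> t) (topspace M) (topspace M)"
    using assms by (auto simp: smooth_manifold_def Ck_diffeomorphism_def)
  have "chart_inv D \<eta> \<in> topspace M"
    using chart_inv_in_dom[OF D \<eta>(1)] chart_dom_subset[OF D] by blast
  then show "local_rep (x t) D \<eta> = (local_rep (deturck_flow M x \<psi> t) C \<circ> local_rep2 (\<psi> t) D C) \<eta>"
    using r(2)[of \<eta>] \<eta> bij by (simp add: deturck_flow_def bij_betw_inv_into_left)
qed

text \<open>The image of one chart under the inverse diffeomorphism need not lie in a single chart,
  so regularity is shown near each point, with a chart \<open>D\<close> depending on the
  point.\<close>

lemma Ck_map_deturck_flow:
  assumes M: "smooth_manifold M A" "Ck_diffeomorphism k M A (\<psi> t)" and x: "Ck_map k A (x t)"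
  shows "Ck_map k A (deturck_flow M x \<psi> t)"
  unfolding Ck_map_def
proof (rule ballI, rule Ck_on_localI)
  fix C \<theta> assume C: "C \<in> A" and \<theta>: "\<theta> \<in> chart_img C"
  define \<phi> where "\<phi> = inv_into (topspace M) (\<psi> t)"
  have C': "is_chart M C" using M C by (auto simp: smooth_manifold_def)
  have bij: "bij_betw (\<psi> t) (topspace M) (topspace M)"
    using M by (simp add: Ck_diffeomorphism_def)
  have "chart_inv C \<theta> \<in> topspace M"
    using chart_inv_in_dom[OF C' \<theta>] chart_dom_subset[OF C'] by blast
  then have "\<phi> (chart_inv C \<theta>) \<in> topspace M"
    using bij by (metis \<phi>_def bij_betw_def inv_into_into)
  then obtain D where D: "D \<in> A" "\<phi> (chart_inv C \<theta>) \<in> chart_dom D"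
    using M by (auto simp: smooth_manifold_def)
  define V where "V = {\<theta> \<in> chart_img C. \<phi> (chart_inv C \<theta>) \<in> chart_dom D}"
  note r = diffeomorphism_in_charts[OF M C D(1), folded \<phi>_def, folded V_def]
  have "Ck_on k (local_rep (x t) D \<circ> local_rep2 \<phi> C D) V"
  proof (rule Ck_on_compose[OF r(1) _ r(3)])
    show "Ck_on k (local_rep (x t) D) (chart_img D)" using x D by (simp add: Ck_map_def)
    show "local_rep2 \<phi> C D ` V \<subseteq> chart_img D" using r(5) by blast
  qed
  moreover have "local_rep (deturck_flow M x \<psi> t) C \<theta> = (local_rep (x t) D \<circ> local_rep2 \<phi> C D) \<theta>" if "\<theta> \<in> V" for \<theta>
    using deturck_flow_local_rep(1)[where \<psi> = \<psi> and t = t, OF M C D(1), folded \<phi>_def, of \<theta> x] that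
    unfolding V_def by simp
  ultimately have "Ck_on k (local_rep (deturck_flow M x \<psi> t) C) V"
    using Ck_on_cong[OF r(1), of "local_rep (deturck_flow M x \<psi> t) C" "local_rep (x t) D \<circ> local_rep2 \<phi> C D"]
    by blast
  moreover have "\<theta> \<in> V" using \<theta> D by (simp add: V_def)
  ultimately show "\<exists>V. open V \<and> \<theta> \<in> V \<and> Ck_on k (local_rep (deturck_flow M x \<psi> t) C) V"
    using r(1) by blast
qed

section \<open>The time derivative of the DeTurck flow\<close>

lemma open_product_nhd:
  assumes "openin (top_of_set (S \<times> U)) W" "open U" "(t, \<theta>) \<in> W"
  shows "\<exists>d>0. (S \<inter> ball t d) \<times> ball \<theta> d \<subseteq> W \<and> ball \<theta> d \<subseteq> U"
proof -
  obtain Q where Q: "open Q" "W = (S \<times> U) \<inter> Q"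
    using assms(1) unfolding openin_open by auto
  have "(t, \<theta>) \<in> Q" using assms(3) Q by blast
  obtain P R where PR: "open P" "open R" "(t, \<theta>) \<in> P \<times> R" "P \<times> R \<subseteq> Q"
    by (rule open_prod_elim[OF Q(1) \<open>(t, \<theta>) \<in> Q\<close>])
  obtain d1 where d1: "d1 > 0" "ball t d1 \<subseteq> P" using PR openE by blast
  have "open (R \<inter> U)" "\<theta> \<in> R \<inter> U" using PR assms Q by auto
  then obtain d2 where d2: "d2 > 0" "ball \<theta> d2 \<subseteq> R \<inter> U" using openE by blast
  show ?thesis
  proof (intro exI[of _ "min d1 d2"] conjI)
    have "ball t (min d1 d2) \<subseteq> P" "ball \<theta> (min d1 d2) \<subseteq> R \<inter> U"
      using d1 d2 by (auto simp: subset_iff)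
    then show "(S \<inter> ball t (min d1 d2)) \<times> ball \<theta> (min d1 d2) \<subseteq> W" "ball \<theta> (min d1 d2) \<subseteq> U"
      using PR Q(2) by blast+
  qed (use d1 d2 in simp)
qed

text \<open>Guarantees that derivatives within the time interval are unique, also the one-sided one
  at time 0.\<close>

lemma at_within_half_open_neq_bot:
  fixes t T :: real
  assumes "t \<in> {0..<T}"
  shows "at t within {0..<T} \<noteq> bot"
proof -
  have "t islimpt {t<..<T}" using assms by (auto intro: islimpt_greaterThanLessThan1)
  then have "t islimpt {0..<T}" by (rule islimpt_subset) (use assms in auto)
  then show ?thesis by (simp add: trivial_limit_within)
qed

text \<open>In the chart \<open>D\<close> the flow at \<open>p\<close> is
  \<open>X s (\<eta> s)\<close>, where \<eta> follows the preimage of \<open>p\<close>.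
  Differentiating jointly gives \<open>v\<close> plus the differential of \<open>X t\<close> at the
  velocity of \<eta>, which is minus the differential of \<Phi> at \<open>l\<close>; the two
  differentials compose to that of the flow's own representation \<open>Y\<close>.\<close>

lemma deturck_flow_has_vector_derivative:
  fixes A :: "('a, 'n::finite) chart set" and x :: "real \<Rightarrow> 'a \<Rightarrow> real^'m::finite"
  assumes M: "smooth_manifold M A" "compact_space M"
    and x: "C21_map T A x"
    and \<psi>: "C21_selfmap T M A \<psi>" "\<And>t. t \<in> {0..<T} \<Longrightarrow> Ck_diffeomorphism 2 M A (\<psi> t)"
    and t: "t \<in> {0..<T}" and C: "C \<in> A" "p \<in> chart_dom C"
    and D: "D \<in> A" "q \<in> chart_dom D" "q = inv_into (topspace M) (\<psi> t) p"
    and dx: "((\<lambda>s. x s q) has_vector_derivative v) (at t within {0..<T})"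
    and d\<psi>: "((\<lambda>s. chart_map C (\<psi> s q)) has_vector_derivative l) (at t within {0..<T})"
  shows "((\<lambda>s. deturck_flow M x \<psi> s p) has_vector_derivative
      v - frechet_derivative (local_rep (deturck_flow M x \<psi> t) C) (at (chart_map C p)) l) (at t within {0..<T})"
proof -
  define \<phi> where "\<phi> s = inv_into (topspace M) (\<psi> s)" for s
  define \<theta> where "\<theta> = chart_map C p"
  define \<eta> where "\<eta> s = chart_map D (\<phi> s p)" for s
  define X where "X s = local_rep (x s) D" for s
  define \<Psi> where "\<Psi> s = local_rep2 (\<psi> s) D C" for s
  define Y where "Y = local_rep (deturck_flow M x \<psi> t) C"
  define \<Phi> where "\<Phi> = local_rep2 (\<phi> t) C D"
  have haus: "Hausdorff_space M" and C': "is_chart M C" and D': "is_chart M D"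
    using M C D by (auto simp: smooth_manifold_def)
  have bij: "bij_betw (\<psi> s) (topspace M) (topspace M)" if "s \<in> {0..<T}" for s
    using \<psi>(2)[OF that] by (simp add: Ck_diffeomorphism_def)
  have cont: "continuous_map (prod_topology (top_of_set {0..<T}) M) M (\<lambda>(s, p). \<psi> s p)"
    using \<psi>(1) by (simp add: C21_selfmap_def)
  have p: "p \<in> topspace M" using C C' chart_dom_subset by blast
  have q: "q = \<phi> t p" using D by (simp add: \<phi>_def)
  have \<psi>\<phi>: "\<psi> s (\<phi> s p) = p" if "s \<in> {0..<T}" for s
    using bij_betw_inv_into_right[OF bij[OF that] p] by (simp add: \<phi>_def)
  note inv_D = chart_inv_chart_map[OF D']
  define V where "V = {\<theta> \<in> chart_img C. \<phi> t (chart_inv C \<theta>) \<in> chart_dom D}"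
  define U where "U = {\<eta> \<in> chart_img D. \<psi> t (chart_inv D \<eta>) \<in> chart_dom C}"
  note r = diffeomorphism_in_charts[OF M(1) \<psi>(2)[OF t] C(1) D(1), folded \<phi>_def, folded V_def U_def, folded \<Psi>_def \<Phi>_def]
  have \<theta>V: "\<theta> \<in> V"
    using C D q by (simp add: V_def \<theta>_def chart_map_in_img[OF C'] chart_inv_chart_map[OF C'])
  have \<Phi>\<theta>: "\<Phi> \<theta> = \<eta> t"
    using C by (simp add: \<Phi>_def \<theta>_def \<eta>_def chart_inv_chart_map[OF C'])
  have \<eta>U: "\<eta> t \<in> U" "\<Psi> t (\<eta> t) = \<theta>" using r(5)[OF \<theta>V] by (simp_all add: \<Phi>\<theta>)

  \<comment> \<open>The space-time domain of the representation of \<psi>. It is relatively open, so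
    it contains a product of balls around the base point, as joint differentiability
    requires.\<close>
  define W where "W = {(s, \<eta>). s \<in> {0..<T} \<and> \<eta> \<in> chart_img D \<and> \<psi> s (chart_inv D \<eta>) \<in> chart_dom C}"
  have "continuous_map (prod_topology (top_of_set {0..<T}) (top_of_set (chart_img D))) M
      ((\<lambda>(s, p). \<psi> s p) \<circ> (\<lambda>(s, \<eta>). (s, chart_inv D \<eta>)))"
    by (rule continuous_map_compose[OF _ cont], subst continuous_map_prod_top)
      (simp add: continuous_map_chart_inv[OF D'])
  from openin_continuous_map_preimage[OF this, of "chart_dom C"] C'
  have "openin (prod_topology (top_of_set {0..<T}) (top_of_set (chart_img D))) W"
    by (simp add: is_chart_def W_def case_prod_beta' Collect_case_prod_Sigma[symmetric] mem_Times_iff conj_ac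
        cong: conj_cong)
  then have "openin (top_of_set ({0..<T} \<times> chart_img D)) W"
    by (simp add: prod_topology_subtopology_eu)
  moreover have "(t, \<eta> t) \<in> W" using \<eta>U t by (simp add: W_def U_def)
  moreover have "open (chart_img D)" using D' by (simp add: is_chart_def)
  ultimately obtain d where d: "d > 0" "({0..<T} \<inter> ball t d) \<times> ball (\<eta> t) d \<subseteq> W" "ball (\<eta> t) d \<subseteq> chart_img D"
    using open_product_nhd by blast

  \<comment> \<open>Compactness of \<open>M\<close> enters here: the preimages of \<open>p\<close>
    cannot jump away from \<open>q\<close>.\<close>
  have near: "\<forall>\<^sub>F s in at t within {0..<T}. \<phi> s p \<in> {r \<in> chart_dom D. chart_map D r \<in> ball (\<eta> t) e}" if "e > 0" for e
    unfolding \<phi>_def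
    by (rule eventually_inv_into_in_openin[OF M(2) haus cont bij t p openin_chart_map_preimage[OF D']])
      (use D q that in \<open>simp_all add: \<eta>_def \<phi>_def\<close>)
  then obtain e where e: "e > 0" "\<And>s. s \<in> {0..<T} \<Longrightarrow> s \<noteq> t \<Longrightarrow> dist s t < e \<Longrightarrow>
      \<phi> s p \<in> chart_dom D \<and> chart_map D (\<phi> s p) \<in> ball (\<eta> t) d"
    using d(1) unfolding eventually_at by blast
  \<comment> \<open>On these times the curve stays in the chart \<open>D\<close> and in the ball;
    the restriction does not change the filter at \<open>t\<close>.\<close>
  define S where "S = {0..<T} \<inter> ball t (min d e)"
  have tS: "t \<in> S" using t d e by (simp add: S_def)
  have S: "s \<in> {0..<T}" "s \<in> ball t d" "\<phi> s p \<in> chart_dom D" "\<eta> s \<in> ball (\<eta> t) d" if "s \<in> S" for s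
  proof -
    show "s \<in> {0..<T}" "s \<in> ball t d" using that by (auto simp: S_def)
    show "\<phi> s p \<in> chart_dom D" "\<eta> s \<in> ball (\<eta> t) d"
      using e(2)[of s] that D q d by (cases "s = t"; auto simp: S_def \<eta>_def dist_commute)+
  qed
  have within: "at t within S = at t within {0..<T}"
    by (rule at_within_nhd[of t "ball t (min d e)"]) (use d e in \<open>auto simp: S_def\<close>)
  have \<eta>_tendsto: "(\<eta> \<longlongrightarrow> \<eta> t) (at t within S)"
    unfolding within
  proof (rule tendstoI)
    fix e :: real assume "e > 0"
    from near[OF this] show "\<forall>\<^sub>F s in at t within {0..<T}. dist (\<eta> s) (\<eta> t) < e"
      by (rule eventually_mono) (simp add: \<eta>_def dist_commute)
  qed

  have sub: "S \<times> ball (\<eta> t) d \<subseteq> ({0..<T} \<inter> ball t d) \<times> ball (\<eta> t) d"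
    by (auto simp: S_def)
  have X_joint: "((\<lambda>(s, \<eta>). X s \<eta>) has_derivative (\<lambda>(s, u). s *\<^sub>R v + frechet_derivative (X t) (at (\<eta> t)) u))
      (at (t, \<eta> t) within S \<times> ball (\<eta> t) d)"
  proof -
    have "vector_derivative (\<lambda>s. X s (\<eta> t)) (at t within {0..<T}) = v"
      using dx D q by (intro vector_derivative_within at_within_half_open_neq_bot[OF t])
        (simp add: X_def \<eta>_def inv_D)
    moreover have "C21_on T ({0..<T} \<times> chart_img D) X"
      using x D(1) by (simp add: C21_map_def X_def[abs_def])
    moreover have "({0..<T} \<inter> ball t d) \<times> ball (\<eta> t) d \<subseteq> {0..<T} \<times> chart_img D"
      using d by auto
    ultimately show ?thesis
      using has_derivative_subset[OF C21_on_has_derivative sub] t d by metis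
  qed
  have \<Psi>_joint: "((\<lambda>(s, \<eta>). \<Psi> s \<eta>) has_derivative (\<lambda>(s, u). s *\<^sub>R l + frechet_derivative (\<Psi> t) (at (\<eta> t)) u))
      (at (t, \<eta> t) within S \<times> ball (\<eta> t) d)"
  proof -
    have "vector_derivative (\<lambda>s. \<Psi> s (\<eta> t)) (at t within {0..<T}) = l"
      using d\<psi> D q by (intro vector_derivative_within at_within_half_open_neq_bot[OF t])
        (simp add: \<Psi>_def \<eta>_def inv_D)
    moreover have "C21_on T W \<Psi>"
      using \<psi>(1) C(1) D(1) by (simp add: C21_selfmap_def W_def \<Psi>_def[abs_def])
    ultimately show ?thesis
      using has_derivative_subset[OF C21_on_has_derivative sub] t d by metis
  qed

  have dX: "X t differentiable (at (\<eta> t))"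
    using x D(1) t \<eta>U by (auto simp: C21_map_def C21_on_def Ck_on_2_iff X_def U_def)
  have d\<Phi>: "\<Phi> differentiable (at \<theta>)" using r(3) \<theta>V by (simp add: Ck_on_2_iff)
  have d\<Psi>: "\<Psi> t differentiable (at (\<eta> t))" using r(4) \<eta>U by (simp add: Ck_on_2_iff)
  let ?D\<Phi> = "frechet_derivative \<Phi> (at \<theta>)" and ?D\<Psi> = "frechet_derivative (\<Psi> t) (at (\<eta> t))"
  \<comment> \<open>Differentiates the identity \<open>\<Phi> \<circ> \<Psi> t = id\<close>, valid
    on the open set \<open>U\<close>; this supplies the left inverse for the implicit curve.\<close>
  have "?D\<Phi> \<circ> ?D\<Psi> = id"
  proof -
    have "((\<lambda>\<eta>. \<eta>) has_derivative ?D\<Phi> \<circ> ?D\<Psi>) (at (\<eta> t))"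
    proof (rule has_derivative_transform_within_open[OF _ r(2) \<eta>U(1)])
      show "(\<Phi> \<circ> \<Psi> t has_derivative ?D\<Phi> \<circ> ?D\<Psi>) (at (\<eta> t))"
        by (rule diff_chain_at) (use d\<Phi> d\<Psi> \<eta>U in \<open>auto intro: has_derivative_frechet\<close>)
    qed (use r(6) in simp)
    from has_derivative_unique[OF this has_derivative_ident] show ?thesis by (simp add: id_def)
  qed
  then have left_inv: "?D\<Phi> (?D\<Psi> u) = u" for u by (metis comp_apply id_apply)
  \<comment> \<open>Along the curve \<open>\<Psi> s (\<eta> s)\<close> is the constant coordinate
    vector of \<open>p\<close>.\<close>
  have "(\<eta> has_vector_derivative - ?D\<Phi> l) (at t within S)"
  proof (rule implicit_curve_derivative[OF \<Psi>_joint \<eta>_tendsto S(4)])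
    show "(\<lambda>(s, \<eta>). \<Psi> s \<eta>) (s, \<eta> s) = (\<lambda>(s, \<eta>). \<Psi> s \<eta>) (t, \<eta> t)" if "s \<in> S" for s
      using S(1,3)[OF that] S(1,3)[OF tS] \<psi>\<phi> by (simp add: \<Psi>_def \<eta>_def inv_D)
    show "linear ?D\<Phi>" by (rule linear_frechet_derivative[OF d\<Phi>])
  qed (simp_all add: left_inv)
  then have pair: "((\<lambda>s. (s, \<eta> s)) has_derivative (\<lambda>h. (h, h *\<^sub>R (- ?D\<Phi> l)))) (at t within S)"
    unfolding has_vector_derivative_def by (intro has_derivative_Pair has_derivative_ident)
  have "(\<lambda>s. (s, \<eta> s)) ` S \<subseteq> S \<times> ball (\<eta> t) d" using S(4) by auto
  from has_derivative_in_compose[OF pair has_derivative_subset[OF X_joint this]]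
  have "((\<lambda>s. X s (\<eta> s)) has_derivative
      (\<lambda>h. h *\<^sub>R v + frechet_derivative (X t) (at (\<eta> t)) (h *\<^sub>R (- ?D\<Phi> l)))) (at t within S)"
    by simp
  then have "((\<lambda>s. X s (\<eta> s)) has_vector_derivative v - frechet_derivative (X t) (at (\<eta> t)) (?D\<Phi> l)) (at t within S)"
    unfolding has_vector_derivative_def
    by (simp add: linear_scale[OF linear_frechet_derivative[OF dX]] linear_neg[OF linear_frechet_derivative[OF dX]] algebra_simps)
  moreover have "frechet_derivative (X t) (at (\<eta> t)) (?D\<Phi> l) = frechet_derivative Y (at \<theta>) l"
  proof -
    have "(Y has_derivative frechet_derivative (X t) (at (\<eta> t)) \<circ> ?D\<Phi>) (at \<theta>)"
    proof (rule has_derivative_transform_within_open[OF _ r(1) \<theta>V])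
      show "(X t \<circ> \<Phi> has_derivative frechet_derivative (X t) (at (\<eta> t)) \<circ> ?D\<Phi>) (at \<theta>)"
        by (rule diff_chain_at) (use d\<Phi> dX \<Phi>\<theta> in \<open>auto intro: has_derivative_frechet\<close>)
      show "(X t \<circ> \<Phi>) \<theta> = Y \<theta>" if "\<theta> \<in> V" for \<theta>
        using deturck_flow_local_rep(1)[where \<psi> = \<psi> and t = t, OF M(1) \<psi>(2)[OF t] C(1) D(1), folded \<phi>_def, of \<theta> x] that
        unfolding V_def X_def \<Phi>_def Y_def by simp
    qed
    from frechet_derivative_at[OF this] show ?thesis by (metis comp_apply)
  qed
  moreover have "X s (\<eta> s) = deturck_flow M x \<psi> s p" if "s \<in> S" for s
    using S(3)[OF that] by (simp add: X_def \<eta>_def inv_D deturck_flow_def \<phi>_def)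
  ultimately have "((\<lambda>s. deturck_flow M x \<psi> s p) has_vector_derivative v - frechet_derivative Y (at \<theta>) l) (at t within S)"
    using has_vector_derivative_transform[OF tS] by (metis (no_types, lifting))
  then show ?thesis by (simp add: within Y_def \<theta>_def)
qed

text \<open>Gauss formula and composition formula combined: the Laplacian of \<open>X\<close> for
  its own metric is the mean curvature vector, and it also equals the trace of the Hessian of the
  flow plus \<open>w\<close>, the differential of the flow at the map Laplacian. The vector
  \<open>w\<close> is tangential, being in the range of the differential of
  \<open>X\<close>.\<close>

lemma trace_hessian_deturck_flow:
  fixes A :: "('a, 'n::finite) chart set" and h :: "('a, 'n) metric" and x :: "real \<Rightarrow> 'a \<Rightarrow> real^'m::finite"
  assumes codim: "CARD('m) = CARD('n) + 1"
    and M: "smooth_manifold M A" and x: "C2_embedding M A (x t)"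
    and \<nu>: "unit_normal_field M A (x t) \<nu>" and H: "is_mean_curvature A (x t) \<nu> H"
    and \<psi>: "Ck_diffeomorphism 2 M A (\<psi> t)"
    and C: "C \<in> A" "p \<in> chart_dom C"
    and D: "D \<in> A" "q \<in> chart_dom D" "q = inv_into (topspace M) (\<psi> t) p"
  defines "xh \<equiv> deturck_flow M x \<psi> t"
  defines "w \<equiv> frechet_derivative (local_rep xh C) (at (chart_map C p))
      (map_laplacian (pullback_metric (x t)) h (\<psi> t) D C (chart_map D q))"
  shows "(\<Sum>i\<in>UNIV. \<Sum>j\<in>UNIV. matrix_inv (pullback_metric xh C (chart_map C p)) $ i $ j *\<^sub>R
      covariant_hessian h xh C i j (chart_map C p)) = - (H (xh p) *\<^sub>R \<nu> (xh p)) - w" (is "?R = _")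
    and "norm (\<nu> (xh p)) = 1" "\<nu> (xh p) \<bullet> w = 0"
proof -
  define \<phi> where "\<phi> = inv_into (topspace M) (\<psi> t)"
  define \<theta> where "\<theta> = chart_map C p"
  define \<eta> where "\<eta> = chart_map D q"
  define X where "X = local_rep (x t) D"
  define \<Psi> where "\<Psi> = local_rep2 (\<psi> t) D C"
  define \<Phi> where "\<Phi> = local_rep2 \<phi> C D"
  define Y where "Y = local_rep xh C"
  have C': "is_chart M C" and D': "is_chart M D"
    using M C D by (auto simp: smooth_manifold_def)
  have q: "q = \<phi> p" using D by (simp add: \<phi>_def)
  define V where "V = {\<theta> \<in> chart_img C. \<phi> (chart_inv C \<theta>) \<in> chart_dom D}"
  define U where "U = {\<eta> \<in> chart_img D. \<psi> t (chart_inv D \<eta>) \<in> chart_dom C}"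
  note r = diffeomorphism_in_charts[OF M \<psi> C(1) D(1), folded \<phi>_def, folded V_def U_def, folded \<Psi>_def \<Phi>_def]
  have \<theta>V: "\<theta> \<in> V"
    using C D q by (simp add: V_def \<theta>_def chart_map_in_img[OF C'] chart_inv_chart_map[OF C'])
  have \<Phi>\<theta>: "\<Phi> \<theta> = \<eta>"
    using C q by (simp add: \<Phi>_def \<theta>_def \<eta>_def chart_inv_chart_map[OF C'])
  have \<eta>U: "\<eta> \<in> U" "\<Psi> \<eta> = \<theta>" using r(5)[OF \<theta>V] by (simp_all add: \<Phi>\<theta>)
  have \<eta>_img: "\<eta> \<in> chart_img D" using \<eta>U by (simp add: U_def)
  have xh: "xh p = X \<eta>"
    using D by (simp add: xh_def deturck_flow_def X_def \<eta>_def chart_inv_chart_map[OF D'])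
  have open_D: "open (chart_img D)" using D' by (simp add: is_chart_def)
  have CkX: "Ck_on 2 X (chart_img D)" and inj: "inj (frechet_derivative X (at \<eta>))" and Ckx: "Ck_map 2 A (x t)"
    using x D(1) \<eta>_img by (auto simp: C2_embedding_def Ck_map_def X_def)
  have CkY: "Ck_on 2 Y V"
    using Ck_map_deturck_flow[where \<psi> = \<psi> and t = t and x = x, OF M \<psi> Ckx] C(1)
    by (auto simp: Ck_map_def Y_def xh_def V_def intro: Ck_on_subset)
  have XY: "X \<eta> = (Y \<circ> \<Psi>) \<eta>" if "\<eta> \<in> U" for \<eta>
    using deturck_flow_local_rep(2)[where \<psi> = \<psi> and t = t, OF M \<psi> C(1) D(1), of \<eta> x] that
    unfolding U_def X_def \<Psi>_def Y_def xh_def by simp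
  have YX: "(X \<circ> \<Phi>) \<theta> = Y \<theta>" if "\<theta> \<in> V" for \<theta>
    using deturck_flow_local_rep(1)[where \<psi> = \<psi> and t = t, OF M \<psi> C(1) D(1), folded \<phi>_def, of \<theta> x] that
    unfolding V_def X_def \<Phi>_def Y_def xh_def by simp

  \<comment> \<open>\<open>X\<close> and \<open>Y \<circ> \<Psi>\<close> are known to agree on the
    open set \<open>U\<close>; derivatives and injectivity are therefore transferred at points of
    \<open>U\<close> only.\<close>
  have pd: "partial_deriv i (Y \<circ> \<Psi>) \<eta> = partial_deriv i X \<eta>" if "\<eta> \<in> U" for i \<eta>
    by (rule partial_deriv_cong[OF r(2) that]) (simp only: XY)
  have pd2: "partial_deriv2 i j (Y \<circ> \<Psi>) \<eta> = partial_deriv2 i j X \<eta>" for i j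
    unfolding partial_deriv2_def by (rule partial_deriv_cong[OF r(2) \<eta>U(1)]) (rule pd)
  have dX: "X differentiable (at \<eta>)" using CkX \<eta>_img by (simp add: Ck_on_2_iff)
  have d\<Phi>: "\<Phi> differentiable (at \<theta>)" using r(3) \<theta>V by (simp add: Ck_on_2_iff)
  have dY: "Y differentiable (at \<theta>)" using CkY \<theta>V by (simp add: Ck_on_2_iff)
  have "(Y \<circ> \<Psi> has_derivative frechet_derivative X (at \<eta>)) (at \<eta>)"
    by (rule has_derivative_transform_within_open[OF has_derivative_frechet[OF dX] r(2) \<eta>U(1)]) (rule XY)
  then have inj': "inj (frechet_derivative (Y \<circ> \<Psi>) (at \<eta>))"
    using inj frechet_derivative_at by metis

  define n where "n = \<nu> (X \<eta>)"
  have n: "norm n = 1" "n \<bullet> partial_deriv i X \<eta> = 0" for i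
  proof -
    have "chart_inv D \<eta> \<in> topspace M"
      using chart_inv_in_dom[OF D' \<eta>_img] chart_dom_subset[OF D'] by blast
    then show "norm n = 1" using \<nu> by (simp add: unit_normal_field_def n_def X_def)
    show "n \<bullet> partial_deriv i X \<eta> = 0"
      using \<nu> D(1) \<eta>_img unfolding unit_normal_field_def n_def X_def by simp
  qed
  show "norm (\<nu> (xh p)) = 1" using n(1) by (simp add: xh n_def)

  define L where "L = map_laplacian (pullback_metric (x t)) h (\<psi> t) D C \<eta>"
  have w: "w = frechet_derivative Y (at \<theta>) L"
    by (simp add: w_def Y_def \<theta>_def L_def \<eta>_def)
  have "(Y has_derivative frechet_derivative X (at \<eta>) \<circ> frechet_derivative \<Phi> (at \<theta>)) (at \<theta>)"
  proof (rule has_derivative_transform_within_open[OF _ r(1) \<theta>V])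
    show "(X \<circ> \<Phi> has_derivative frechet_derivative X (at \<eta>) \<circ> frechet_derivative \<Phi> (at \<theta>)) (at \<theta>)"
      by (rule diff_chain_at) (use d\<Phi> dX \<Phi>\<theta> in \<open>auto intro: has_derivative_frechet\<close>)
  qed (rule YX)
  then have "frechet_derivative X (at \<eta>) \<circ> frechet_derivative \<Phi> (at \<theta>) = frechet_derivative Y (at \<theta>)"
    by (rule frechet_derivative_at)
  then have "w = frechet_derivative X (at \<eta>) (frechet_derivative \<Phi> (at \<theta>) L)"
    unfolding w by (metis comp_apply)
  then show "\<nu> (xh p) \<bullet> w = 0"
    by (simp add: frechet_derivative_sum_partial[OF dX] inner_sum_right xh n_def[symmetric] n(2))

  define g where "g = matrix_inv (first_fundamental_form X \<eta>)"
  define \<Gamma> where "\<Gamma> k i j = christoffel (first_fundamental_form X) k i j \<eta>" for k i j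
  define \<Gamma>' where "\<Gamma>' q m r = christoffel (h C) q m r \<theta>" for q m r
  \<comment> \<open>Contracting the Gauss formula with the inverse metric leaves a multiple of the
    normal; the minus sign is that of the definition of mean curvature.\<close>
  have "(\<Sum>i\<in>UNIV. \<Sum>j\<in>UNIV. g $ i $ j *\<^sub>R
      (partial_deriv2 i j X \<eta> - (\<Sum>k\<in>UNIV. \<Gamma> k i j *\<^sub>R partial_deriv k X \<eta>)))
    = (\<Sum>i\<in>UNIV. \<Sum>j\<in>UNIV. (g $ i $ j * (partial_deriv2 i j X \<eta> \<bullet> n)) *\<^sub>R n)"
    unfolding \<Gamma>_def using gauss_formula[OF codim open_D CkX \<eta>_img inj n] by simp
  also have "\<dots> = - (H (X \<eta>) *\<^sub>R n)"
  proof -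
    have "H (X \<eta>) = - (\<Sum>i\<in>UNIV. \<Sum>j\<in>UNIV. g $ i $ j * (partial_deriv2 i j X \<eta> \<bullet> n))"
      using H D(1) \<eta>_img
      unfolding is_mean_curvature_def pullback_metric_eq_first_fundamental_form g_def n_def X_def by blast
    then show ?thesis by (simp add: scaleR_sum_left)
  qed
  finally have mean: "(\<Sum>i\<in>UNIV. \<Sum>j\<in>UNIV. g $ i $ j *\<^sub>R
      (partial_deriv2 i j X \<eta> - (\<Sum>k\<in>UNIV. \<Gamma> k i j *\<^sub>R partial_deriv k X \<eta>))) = - (H (X \<eta>) *\<^sub>R n)" .
  have L: "L $ q = (\<Sum>i\<in>UNIV. \<Sum>j\<in>UNIV. g $ i $ j * (partial_deriv2 i j \<Psi> \<eta> $ q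
       - (\<Sum>k\<in>UNIV. \<Gamma> k i j * partial_deriv k \<Psi> \<eta> $ q)
       + (\<Sum>m\<in>UNIV. \<Sum>r\<in>UNIV. \<Gamma>' q m r * partial_deriv i \<Psi> \<eta> $ m * partial_deriv j \<Psi> \<eta> $ r)))" for q
    unfolding L_def map_laplacian_def Let_def \<Psi>_def[symmetric] \<eta>U(2) \<Gamma>'_def[symmetric]
      pullback_metric_eq_first_fundamental_form X_def[symmetric] g_def[symmetric] \<Gamma>_def[symmetric]
    by simp
  have "\<Psi> ` U \<subseteq> V" using r(6) by blast
  from laplacian_composition[OF r(2) CkY r(4) this \<eta>U(1) inj', of \<Gamma> \<Gamma>']
  have "- (H (X \<eta>) *\<^sub>R n) = ?R + (\<Sum>q\<in>UNIV. L $ q *\<^sub>R partial_deriv q Y \<theta>)"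
    unfolding pd[OF \<eta>U(1)] pd2 \<eta>U(2) g_def[symmetric] mean L[symmetric]
    unfolding covariant_hessian_def pullback_metric_eq_first_fundamental_form Y_def[symmetric] \<theta>_def[symmetric]
      \<Gamma>'_def[symmetric] .
  then show "?R = - (H (xh p) *\<^sub>R \<nu> (xh p)) - w"
    by (simp add: w frechet_derivative_sum_partial[OF dY] xh n_def)
qed

theorem theorem1:
  fixes M :: "'a topology"
    and A :: "('a, 'n::finite) chart set"
    and h :: "('a, 'n) metric"
    and \<alpha> T :: real
    and x :: "real \<Rightarrow> 'a \<Rightarrow> real^'m::finite"
    and x\<^sub>0 :: "'a \<Rightarrow> real^'m"
    and \<nu> :: "real \<Rightarrow> real^'m \<Rightarrow> real^'m"
    and H :: "real \<Rightarrow> real^'m \<Rightarrow> real"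
    and \<psi> :: "real \<Rightarrow> 'a \<Rightarrow> 'a"
  assumes codim: "CARD('m) = CARD('n) + 1"
    and "smooth_manifold M A" "compact_space M" "connected_space M" "orientable M A"
    and "riemannian_metric A h"
    and "\<alpha> > 0" and "T > 0"
    and "C21_map T A x"
    and "\<And>t. t \<in> {0..<T} \<Longrightarrow> C2_embedding M A (x t)"
    and "\<And>t. t \<in> {0..<T} \<Longrightarrow> unit_normal_field M A (x t) (\<nu> t)"
    and "\<And>t. t \<in> {0..<T} \<Longrightarrow> is_mean_curvature A (x t) (\<nu> t) (H t)"
    and "mean_curvature_flow T M x \<nu> H x\<^sub>0"
    and "C21_selfmap T M A \<psi>"
    and "\<And>t. t \<in> {0..<T} \<Longrightarrow> Ck_diffeomorphism 2 M A (\<psi> t)"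
    and "harmonic_map_heat_flow T M A \<alpha> (\<lambda>t. pullback_metric (x t)) h \<psi>"
  shows
    "let xh = deturck_flow M x \<psi>; gh = (\<lambda>t. pullback_metric (xh t)) in
     (\<forall>t\<in>{0..<T}. Ck_map 2 A (xh t)) \<and>
     (\<forall>t\<in>{0..<T}. \<forall>p\<in>topspace M.
        \<exists>v. ((\<lambda>s. xh s p) has_vector_derivative v) (at t within {0..<T}) \<and>
          (\<alpha> *\<^sub>R mat 1 + (1 - \<alpha>) *\<^sub>R tensor (\<nu> t (xh t p)) (\<nu> t (xh t p))) *v v
            = trace_hessian A (gh t) h (xh t) p) \<and>
     (\<forall>p\<in>topspace M. xh 0 p = x\<^sub>0 p) \<and>
     (\<forall>C\<in>A. \<forall>\<theta>\<in>chart_img C.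
        (\<forall>t\<in>{0..<T}.
          \<exists>v. ((\<lambda>s. local_rep (xh s) C \<theta>) has_vector_derivative v) (at t within {0..<T}) \<and>
            (\<alpha> *\<^sub>R mat 1 + (1 - \<alpha>) *\<^sub>R
               tensor (\<nu> t (local_rep (xh t) C \<theta>)) (\<nu> t (local_rep (xh t) C \<theta>))) *v v
            = (\<Sum>i\<in>UNIV. \<Sum>j\<in>UNIV. matrix_inv (gh t C \<theta>) $ i $ j *\<^sub>R
                (partial_deriv2 i j (local_rep (xh t) C) \<theta>
                 - (\<Sum>k\<in>UNIV. christoffel (h C) k i j \<theta> *\<^sub>R
                      partial_deriv k (local_rep (xh t) C) \<theta>)))) \<and>
        local_rep (xh 0) C \<theta> = local_rep x\<^sub>0 C \<theta>)"
proof -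
  define xh where "xh = deturck_flow M x \<psi>"
  \<comment> \<open>The trace computed in one fixed chart; its independence of the chart is
    established only after the evolution equation.\<close>
  define R where "R t C p = (\<Sum>i\<in>UNIV. \<Sum>j\<in>UNIV.
      matrix_inv (pullback_metric (xh t) C (chart_map C p)) $ i $ j *\<^sub>R covariant_hessian h (xh t) C i j (chart_map C p))"
    for t C p
  define N where "N t y = \<alpha> *\<^sub>R mat 1 + (1 - \<alpha>) *\<^sub>R tensor (\<nu> t y) (\<nu> t y)" for t y
  have charts: "is_chart M C" if "C \<in> A" for C using assms(2) that by (simp add: smooth_manifold_def)
  have cover: "\<exists>C\<in>A. p \<in> chart_dom C" if "p \<in> topspace M" for p
    using assms(2) that by (auto simp: smooth_manifold_def)
  have Ck: "Ck_map 2 A (xh t)" if "t \<in> {0..<T}" for t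
    unfolding xh_def using assms(10)[OF that]
    by (intro Ck_map_deturck_flow[where \<psi> = \<psi> and t = t and x = x, OF assms(2) assms(15)[OF that]]) (simp add: C2_embedding_def)
  have initial: "xh 0 p = x\<^sub>0 p" if p: "p \<in> topspace M" for p
  proof -
    have 0: "\<psi> 0 r = r" if "r \<in> topspace M" for r
      using assms(16) that by (simp add: harmonic_map_heat_flow_def)
    \<comment> \<open>The assumption \<open>T > 0\<close> places time 0 in the interval of
      existence.\<close>
    have "bij_betw (\<psi> 0) (topspace M) (topspace M)"
      using assms(8,15) by (simp add: Ck_diffeomorphism_def)
    then have "inv_into (topspace M) (\<psi> 0) p = p"
      using bij_betw_inv_into_left 0 p by metis
    then show ?thesis
      using assms(13) p by (simp add: xh_def deturck_flow_def mean_curvature_flow_def)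
  qed
  have flow: "\<exists>v. ((\<lambda>s. xh s p) has_vector_derivative v) (at t within {0..<T}) \<and> N t (xh t p) *v v = R t C p"
    if t: "t \<in> {0..<T}" and C: "C \<in> A" "p \<in> chart_dom C" for t C p
  proof -
    note \<psi> = assms(15)[OF t]
    have bij: "bij_betw (\<psi> t) (topspace M) (topspace M)"
      using \<psi> by (simp add: Ck_diffeomorphism_def)
    have p: "p \<in> topspace M" using C charts chart_dom_subset by blast
    define q where "q = inv_into (topspace M) (\<psi> t) p"
    have q: "q \<in> topspace M" "\<psi> t q = p"
      using bij p by (auto simp: q_def bij_betw_inv_into_right bij_betw_def intro: inv_into_into)
    obtain D where D: "D \<in> A" "q \<in> chart_dom D" using cover q by blast
    define l where "l = map_laplacian (pullback_metric (x t)) h (\<psi> t) D C (chart_map D q)"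
    define w where "w = frechet_derivative (local_rep (xh t) C) (at (chart_map C p)) l"
    have xq: "x t q = xh t p" by (simp add: xh_def deturck_flow_def q_def)
    have dx: "((\<lambda>s. x s q) has_vector_derivative - (H t (xh t p) *\<^sub>R \<nu> t (xh t p))) (at t within {0..<T})"
      using assms(13) t q by (auto simp: mean_curvature_flow_def xq[symmetric])
    have d\<psi>: "((\<lambda>s. chart_map C (\<psi> s q)) has_vector_derivative (1/\<alpha>) *\<^sub>R l) (at t within {0..<T})"
      using assms(16) t C D q by (simp add: harmonic_map_heat_flow_def l_def)
    have "((\<lambda>s. xh s p) has_vector_derivative - (H t (xh t p) *\<^sub>R \<nu> t (xh t p))
        - frechet_derivative (local_rep (xh t) C) (at (chart_map C p)) ((1/\<alpha>) *\<^sub>R l)) (at t within {0..<T})"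
      using deturck_flow_has_vector_derivative[OF assms(2,3,9,14) _ t C D q_def dx d\<psi>] assms(15)
      unfolding xh_def by blast
    moreover have "frechet_derivative (local_rep (xh t) C) (at (chart_map C p)) ((1/\<alpha>) *\<^sub>R l) = (1/\<alpha>) *\<^sub>R w"
    proof -
      have "local_rep (xh t) C differentiable (at (chart_map C p))"
        using Ck[OF t] C chart_map_in_img[OF charts[OF C(1)]] by (simp add: Ck_map_def Ck_on_2_iff)
      then show ?thesis unfolding w_def by (rule linear_scale[OF linear_frechet_derivative])
    qed
    \<comment> \<open>The velocity is a normal part plus 1/\<alpha> times a tangential part; the
      operator keeps the first and removes the factor from the second, which leaves the expression
      found for the trace.\<close>
    moreover have "N t (xh t p) *v (- (H t (xh t p) *\<^sub>R \<nu> t (xh t p)) - (1/\<alpha>) *\<^sub>R w) = R t C p"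
    proof -
      note hyps = codim assms(2) assms(10-12)[OF t] \<psi> C D q_def
      note trace = trace_hessian_deturck_flow(1)[where x = x and t = t and \<psi> = \<psi> and h = h, OF hyps,
          folded xh_def, folded l_def, folded w_def, folded R_def]
      note unit = trace_hessian_deturck_flow(2)[where x = x and t = t and \<psi> = \<psi>, OF hyps, folded xh_def]
      note normal = trace_hessian_deturck_flow(3)[where x = x and t = t and \<psi> = \<psi> and h = h, OF hyps,
          folded xh_def, folded l_def, folded w_def]
      show ?thesis
        using deturck_operator_mult[OF unit normal, of \<alpha> "- H t (xh t p)"] trace assms(7) by (simp add: N_def)
    qed
    ultimately show ?thesis by auto
  qed
  have trace: "trace_hessian A (pullback_metric (xh t)) h (xh t) p = R t C p"
    if t: "t \<in> {0..<T}" and C: "C \<in> A" "p \<in> chart_dom C" for t C p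
    unfolding trace_hessian_def R_def[symmetric]
  proof (rule the_equality)
    show "\<forall>D\<in>A. p \<in> chart_dom D \<longrightarrow> R t C p = R t D p"
      \<comment> \<open>For each chart the trace is the same operator applied to the velocity at
        \<open>p\<close>, and the velocity is unique; this justifies the definite description in
        \<open>trace_hessian\<close>.\<close>
      using flow[OF t C] flow[OF t] vector_derivative_unique_within[OF at_within_half_open_neq_bot[OF t]] by metis
  qed (use C in blast)
  have global: "\<exists>v. ((\<lambda>s. xh s p) has_vector_derivative v) (at t within {0..<T}) \<and>
      N t (xh t p) *v v = trace_hessian A (pullback_metric (xh t)) h (xh t) p"
    if "t \<in> {0..<T}" "p \<in> topspace M" for t p
    using cover[OF that(2)] flow[OF that(1)] trace[OF that(1)] by metis
  have local: "\<exists>v. ((\<lambda>s. local_rep (xh s) C \<theta>) has_vector_derivative v) (at t within {0..<T}) \<and>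
      N t (local_rep (xh t) C \<theta>) *v v = (\<Sum>i\<in>UNIV. \<Sum>j\<in>UNIV. matrix_inv (pullback_metric (xh t) C \<theta>) $ i $ j *\<^sub>R
        (partial_deriv2 i j (local_rep (xh t) C) \<theta>
          - (\<Sum>k\<in>UNIV. christoffel (h C) k i j \<theta> *\<^sub>R partial_deriv k (local_rep (xh t) C) \<theta>)))"
    if "t \<in> {0..<T}" "C \<in> A" "\<theta> \<in> chart_img C" for t C \<theta>
    using flow[OF that(1,2) chart_inv_in_dom[OF charts[OF that(2)] that(3)]]
    unfolding R_def covariant_hessian_def chart_map_chart_inv[OF charts[OF that(2)] that(3)] by simp
  have local_initial: "local_rep (xh 0) C \<theta> = local_rep x\<^sub>0 C \<theta>" if "C \<in> A" "\<theta> \<in> chart_img C" for C \<theta>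
    using initial chart_inv_in_dom[OF charts[OF that(1)] that(2)] chart_dom_subset[OF charts[OF that(1)]] by auto
  show ?thesis
    unfolding Let_def xh_def[symmetric] N_def[symmetric]
    by (intro conjI ballI) (rule Ck global initial local local_initial; assumption)+
qed

end
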